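(* Let $k$ be an algebraically closed field of characteristic $0$, and let $\mathcal{F}_{El}$ be the functor of elliptic curves, assigning to each field extension $K/k$ the set $\mathcal{F}_{El}(K)=(K\times K)/\!\sim$, where $(a,b)\sim(a',b')$ if and only if there exists $\lambda\in K^*$ with $a'=a\lambda^4$ and $b'=b\lambda^6$. Then $$\operatorname{ed}(\mathcal{F}_{El})=2 .$$
   Context: The pair $(a,b)\in K\times K$ represents the curve $y^2=x^3+ax+b$ over $K$; the equivalence relation is isomorphism of such curves. (All pairs $(a,b)$ are allowed in the definition of the functor.) For an inclusion $K_0\subset K$ of extensions of $k$, the map $\mathcal{F}_{El}(K_0)\to\mathcal{F}_{El}(K)$ is induced by $K_0\times K_0\subset K\times K$. Essential dimension: for a covariant functor $\mathcal{F}$ from the category of field extensions of $k$ to sets and $\alpha\in\mathcal{F}(K)$, $\operatorname{ed}(\alpha)$ is the minimum of $\operatorname{trdeg}_k K_0$ over all intermediate fields $k\subset K_0\subset K$ such that $\alpha$ lies in the image of $\mathcal{F}(K_0)\to\mathcal{F}(K)$; and $\operatorname{ed}(\mathcal{F})$ is the maximum of $\operatorname{ed}(\alpha)$ over all field extensions $K/k$ and all $\alpha\in\mathcal{F}(K)$. *)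

theory Defs
  imports "HOL-Algebra.Algebra" "HOL-Library.Extended_Nat"
begin

section \<open>Field extensions of a base field\<close>

text \<open>
  An extension of \<open>k\<close> is a field \<open>K\<close> together with an embedding \<open>emb K\<close> of \<open>k\<close> into it.
  HOL cannot quantify over types inside a definition, so all extensions have their carrier in one
  type \<open>'b\<close>. Asking for an embedding rather than for a literal inclusion leaves room for proper
  extensions even when \<open>carrier k\<close> is all of its type. If \<open>carrier k\<close> does not inject into
  \<open>'b\<close>, then there are no extensions at all and suprema over them degenerate. Elements of \<open>'b\<close> outside
  \<open>carrier K\<close> play no role.
\<close>

record ('a, 'b) field_ext = "'b ring" +
  emb :: "'a \<Rightarrow> 'b"

definition field_extension :: "('a, 'm) ring_scheme \<Rightarrow> ('a, 'b) field_ext \<Rightarrow> bool" where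
  "field_extension k K \<longleftrightarrow> field k \<and> field K \<and> emb K \<in> ring_hom k K"

definition ext_hom ::
  "('a, 'm) ring_scheme \<Rightarrow> ('a, 'b) field_ext \<Rightarrow> ('a, 'b) field_ext \<Rightarrow> ('b \<Rightarrow> 'b) set" where
  "ext_hom k K L = {f \<in> ring_hom K L. \<forall>a\<in>carrier k. f (emb K a) = emb L a}"

definition intermediate_field ::
  "('a, 'm) ring_scheme \<Rightarrow> ('a, 'b) field_ext \<Rightarrow> 'b set \<Rightarrow> bool" where
  "intermediate_field k K K0 \<longleftrightarrow> subfield K0 K \<and> emb K ` carrier k \<subseteq> K0"

text \<open>An intermediate field, as an extension of \<open>k\<close> in its own right.\<close>

abbreviation restrict_ext :: "('a, 'b) field_ext \<Rightarrow> 'b set \<Rightarrow> ('a, 'b) field_ext" where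
  "restrict_ext K K0 \<equiv> K\<lparr>carrier := K0\<rparr>"


section \<open>Transcendence degree\<close>

text \<open>
  A polynomial over \<open>k\<close> whose variables are indexed by a subset \<open>S\<close> of \<open>K\<close> is an element of
  \<open>ring.indexed_pset k S (carrier k)\<close>: a finitely supported function sending a monomial,
  i.e. a finite multiset over \<open>S\<close>, to its coefficient. It is evaluated by
  substituting for each variable its index.
\<close>

definition eval_at_indices ::
  "('a, 'm) ring_scheme \<Rightarrow> ('a, 'b) field_ext \<Rightarrow> ('b multiset \<Rightarrow> 'a) \<Rightarrow> 'b" where
  "eval_at_indices k K P =
     (\<Oplus>\<^bsub>K\<^esub>m\<in>{m. P m \<noteq> \<zero>\<^bsub>k\<^esub>}.
        emb K (P m) \<otimes>\<^bsub>K\<^esub> (\<Otimes>\<^bsub>K\<^esub>x\<in>set_mset m. x [^]\<^bsub>K\<^esub> count m x))"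

definition algebraically_independent ::
  "('a, 'm) ring_scheme \<Rightarrow> ('a, 'b) field_ext \<Rightarrow> 'b set \<Rightarrow> bool" where
  "algebraically_independent k K S \<longleftrightarrow>
     S \<subseteq> carrier K \<and>
     (\<forall>P\<in>ring.indexed_pset k S (carrier k).
        eval_at_indices k K P = \<zero>\<^bsub>K\<^esub> \<longrightarrow> P = (\<lambda>_. \<zero>\<^bsub>k\<^esub>))"

text \<open>
  The largest cardinality of an algebraically independent subset. Subsets of independent sets
  are independent, so finite sets suffice: the value is \<open>\<infinity>\<close> exactly if there is
  no finite transcendence basis.
\<close>

definition trdeg :: "('a, 'm) ring_scheme \<Rightarrow> ('a, 'b) field_ext \<Rightarrow> enat" where
  "trdeg k K = (SUP S\<in>{S. finite S \<and> algebraically_independent k K S}. enat (card S))"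


section \<open>Functors on field extensions and essential dimension\<close>

record ('a, 'b, 'c) ext_functor =
  fobj :: "('a, 'b) field_ext \<Rightarrow> 'c set"
  fmap :: "('a, 'b) field_ext \<Rightarrow> ('a, 'b) field_ext \<Rightarrow> ('b \<Rightarrow> 'b) \<Rightarrow> 'c \<Rightarrow> 'c"

definition covariant_functor ::
  "('a, 'm) ring_scheme \<Rightarrow> ('a, 'b, 'c) ext_functor \<Rightarrow> bool" where
  "covariant_functor k F \<longleftrightarrow>
     (\<forall>K L f. field_extension k K \<longrightarrow> field_extension k L \<longrightarrow> f \<in> ext_hom k K L \<longrightarrow>
        fmap F K L f \<in> fobj F K \<rightarrow> fobj F L) \<and>
     (\<forall>K. field_extension k K \<longrightarrow> (\<forall>x\<in>fobj F K. fmap F K K (\<lambda>y. y) x = x)) \<and>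
     (\<forall>K L M f g. field_extension k K \<longrightarrow> field_extension k L \<longrightarrow> field_extension k M \<longrightarrow>
        f \<in> ext_hom k K L \<longrightarrow> g \<in> ext_hom k L M \<longrightarrow>
        (\<forall>x\<in>fobj F K. fmap F K M (g \<circ> f) x = fmap F L M g (fmap F K L f x)))"

text \<open>
  Infima of nonempty sets of \<open>enat\<close> are minima (\<open>K0 = K\<close> shows that the set below is nonempty),
  and a finite supremum of a nonempty set of \<open>enat\<close> is a maximum.
\<close>

definition ess_dim_elem ::
  "('a, 'm) ring_scheme \<Rightarrow> ('a, 'b, 'c) ext_functor \<Rightarrow> ('a, 'b) field_ext \<Rightarrow> 'c \<Rightarrow> enat" where
  "ess_dim_elem k F K \<alpha> =
     (INF K0\<in>{K0. intermediate_field k K K0 \<and>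
                  \<alpha> \<in> fmap F (restrict_ext K K0) K (\<lambda>x. x) ` fobj F (restrict_ext K K0)}.
        trdeg k (restrict_ext K K0))"

definition ess_dim :: "('a, 'm) ring_scheme \<Rightarrow> ('a, 'b, 'c) ext_functor \<Rightarrow> enat" where
  "ess_dim k F = (SUP K\<in>{K. field_extension k K}. SUP \<alpha>\<in>fobj F K. ess_dim_elem k F K \<alpha>)"


section \<open>The functor of elliptic curves\<close>

text \<open>\<open>(a, b)\<close> stands for the curve \<open>y\<^sup>2 = x\<^sup>3 + a x + b\<close>; singular curves are allowed.\<close>

definition curve_iso :: "('b, 'n) ring_scheme \<Rightarrow> (('b \<times> 'b) \<times> ('b \<times> 'b)) set" where
  "curve_iso K =
     {((a, b), (a', b')).
        a \<in> carrier K \<and> b \<in> carrier K \<and> a' \<in> carrier K \<and> b' \<in> carrier K \<and>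
        (\<exists>l\<in>Units K. a' = a \<otimes>\<^bsub>K\<^esub> l [^]\<^bsub>K\<^esub> (4::nat) \<and> b' = b \<otimes>\<^bsub>K\<^esub> l [^]\<^bsub>K\<^esub> (6::nat))}"

text \<open>On morphisms, the class of \<open>(a, b)\<close> is sent to the class of \<open>(f a, f b)\<close>.\<close>

definition F_El :: "('a, 'b, ('b \<times> 'b) set) ext_functor" where
  "F_El = \<lparr>fobj = (\<lambda>K. (carrier K \<times> carrier K) // curve_iso K),
           fmap = (\<lambda>K L f C. curve_iso L `` (map_prod f f ` C))\<rparr>"

lemma equiv_curve_iso:
  assumes "field K"
  shows "equiv (carrier K \<times> carrier K) (curve_iso K)"
proof -
  interpret field K by fact
  have "refl_on (carrier K \<times> carrier K) (curve_iso K)"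
    by (auto simp: refl_on_def curve_iso_def intro!: bexI[of _ "\<one>\<^bsub>K\<^esub>"])
  moreover have "sym (curve_iso K)"
  proof (rule symI, clarsimp simp: curve_iso_def)
    fix a b l
    assume ab: "a \<in> carrier K" "b \<in> carrier K" and l: "l \<in> Units K"
    have inv: "l [^]\<^bsub>K\<^esub> n \<otimes>\<^bsub>K\<^esub> (inv\<^bsub>K\<^esub> l) [^]\<^bsub>K\<^esub> n = \<one>\<^bsub>K\<^esub>" for n :: nat
      using l nat_pow_distrib[of l "inv\<^bsub>K\<^esub> l" n] by (simp add: Units_closed)
    have "c = c \<otimes>\<^bsub>K\<^esub> l [^]\<^bsub>K\<^esub> n \<otimes>\<^bsub>K\<^esub> (inv\<^bsub>K\<^esub> l) [^]\<^bsub>K\<^esub> n"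
      if "c \<in> carrier K" for c and n :: nat
      using that l inv[of n] by (simp add: m_assoc Units_closed)
    then show "\<exists>u\<in>Units K.
        a = a \<otimes>\<^bsub>K\<^esub> l [^]\<^bsub>K\<^esub> (4::nat) \<otimes>\<^bsub>K\<^esub> u [^]\<^bsub>K\<^esub> (4::nat) \<and>
        b = b \<otimes>\<^bsub>K\<^esub> l [^]\<^bsub>K\<^esub> (6::nat) \<otimes>\<^bsub>K\<^esub> u [^]\<^bsub>K\<^esub> (6::nat)"
      using ab Units_inv_Units[OF l] by blast
  qed
  moreover have "trans (curve_iso K)"
  proof (rule transI, clarsimp simp: curve_iso_def)
    fix a b l u
    assume ab: "a \<in> carrier K" "b \<in> carrier K" and l: "l \<in> Units K" "u \<in> Units K"
    have "c \<otimes>\<^bsub>K\<^esub> l [^]\<^bsub>K\<^esub> n \<otimes>\<^bsub>K\<^esub> u [^]\<^bsub>K\<^esub> n = c \<otimes>\<^bsub>K\<^esub> (l \<otimes>\<^bsub>K\<^esub> u) [^]\<^bsub>K\<^esub> n"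
      if "c \<in> carrier K" for c and n :: nat
      using that l by (simp add: m_assoc nat_pow_distrib Units_closed)
    then show "\<exists>v\<in>Units K.
        a \<otimes>\<^bsub>K\<^esub> l [^]\<^bsub>K\<^esub> (4::nat) \<otimes>\<^bsub>K\<^esub> u [^]\<^bsub>K\<^esub> (4::nat) = a \<otimes>\<^bsub>K\<^esub> v [^]\<^bsub>K\<^esub> (4::nat) \<and>
        b \<otimes>\<^bsub>K\<^esub> l [^]\<^bsub>K\<^esub> (6::nat) \<otimes>\<^bsub>K\<^esub> u [^]\<^bsub>K\<^esub> (6::nat) = b \<otimes>\<^bsub>K\<^esub> v [^]\<^bsub>K\<^esub> (6::nat)"
      using ab Units_m_closed[OF l] by blast
  qed
  moreover have "curve_iso K \<subseteq> (carrier K \<times> carrier K) \<times> (carrier K \<times> carrier K)"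
    by (auto simp: curve_iso_def)
  ultimately show ?thesis
    by (intro equivI)
qed

lemma curve_iso_hom:
  assumes "field K" "field L" "f \<in> ring_hom K L" "(p, q) \<in> curve_iso K"
  shows "(map_prod f f p, map_prod f f q) \<in> curve_iso L"
proof -
  interpret K: field K by fact
  interpret L: field L by fact
  interpret h: ring_hom_ring K L f
    using assms(3) by (intro ring_hom_ringI2 K.ring_axioms L.ring_axioms)
  obtain a b l where ab: "a \<in> carrier K" "b \<in> carrier K" "p = (a, b)" and l: "l \<in> Units K"
    and q: "q = (a \<otimes>\<^bsub>K\<^esub> l [^]\<^bsub>K\<^esub> (4::nat), b \<otimes>\<^bsub>K\<^esub> l [^]\<^bsub>K\<^esub> (6::nat))"
    using assms(4) by (auto simp: curve_iso_def)
  have lc: "l \<in> carrier K" "inv\<^bsub>K\<^esub> l \<in> carrier K"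
    using l by auto
  have one: "f l \<otimes>\<^bsub>L\<^esub> f (inv\<^bsub>K\<^esub> l) = \<one>\<^bsub>L\<^esub>" "f (inv\<^bsub>K\<^esub> l) \<otimes>\<^bsub>L\<^esub> f l = \<one>\<^bsub>L\<^esub>"
    using l lc h.hom_mult[of l "inv\<^bsub>K\<^esub> l"] h.hom_mult[of "inv\<^bsub>K\<^esub> l" l] by simp_all
  then have "f l \<in> Units L"
    using lc unfolding Units_def mem_Collect_eq by (meson h.hom_closed)
  moreover have "f (l [^]\<^bsub>K\<^esub> n) = f l [^]\<^bsub>L\<^esub> n" for n :: nat
    using lc by (induction n) auto
  ultimately show ?thesis
    using ab lc q by (auto simp: curve_iso_def)
qed

lemma fmap_F_El_class:
  assumes "field K" "field L" "f \<in> ring_hom K L" "p \<in> carrier K \<times> carrier K"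
  shows "fmap F_El K L f (curve_iso K `` {p}) = curve_iso L `` {map_prod f f p}"
proof -
  note eqK = equiv_curve_iso[OF assms(1)] and eqL = equiv_curve_iso[OF assms(2)]
  have "(p, p) \<in> curve_iso K"
    using eqK assms(4) by (meson equivE refl_onD)
  moreover have "curve_iso L `` {map_prod f f q} = curve_iso L `` {map_prod f f p}"
    if "(p, q) \<in> curve_iso K" for q
    using equiv_class_eq[OF eqL curve_iso_hom[OF assms(1-3) that]] by simp
  ultimately show ?thesis
    unfolding F_El_def by fastforce
qed

lemma covariant_functor_F_El:
  fixes k :: "('a, 'm) ring_scheme"
  shows "covariant_functor k (F_El :: ('a, 'b, ('b \<times> 'b) set) ext_functor)"
proof -
  have closed: "map_prod f f p \<in> carrier L \<times> carrier L"
    if "f \<in> ring_hom K L" "p \<in> carrier K \<times> carrier K"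
    for f p and K L :: "('a, 'b) field_ext"
    using that by (auto simp: ring_hom_def)
  have rep: "\<exists>p\<in>carrier K \<times> carrier K. x = curve_iso K `` {p}"
    if "x \<in> fobj F_El K" for x and K :: "('a, 'b) field_ext"
    using that by (auto simp: F_El_def elim!: quotientE)
  have mem: "curve_iso K `` {p} \<in> fobj F_El K"
    if "p \<in> carrier K \<times> carrier K" for p and K :: "('a, 'b) field_ext"
    using that by (simp add: F_El_def quotientI)
  have 1: "fmap F_El K L f \<in> fobj F_El K \<rightarrow> fobj F_El L"
    if "field K" "field L" "f \<in> ring_hom K L" for K L :: "('a, 'b) field_ext" and f
    proof (rule Pi_I)
    fix x assume "x \<in> fobj F_El K"
    then obtain p where p: "p \<in> carrier K \<times> carrier K" "x = curve_iso K `` {p}"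
      using rep by blast
    then show "fmap F_El K L f x \<in> fobj F_El L"
      using fmap_F_El_class[OF that p(1)] mem[OF closed[OF that(3) p(1)]] by simp
  qed
  have 2: "fmap F_El K K (\<lambda>y. y) x = x"
    if "field K" "x \<in> fobj F_El K" for K :: "('a, 'b) field_ext" and x
  proof -
    obtain p where "p \<in> carrier K \<times> carrier K" "x = curve_iso K `` {p}"
      using rep \<open>x \<in> fobj F_El K\<close> by blast
    moreover have "(\<lambda>y. y) \<in> ring_hom K K"
      by (simp add: ring_hom_def)
    ultimately show ?thesis
      using fmap_F_El_class[OF that(1) that(1)] by (cases p) simp
  qed
  have 3: "fmap F_El K M (g \<circ> f) x = fmap F_El L M g (fmap F_El K L f x)"
    if "field K" "field L" "field M" "f \<in> ring_hom K L" "g \<in> ring_hom L M" "x \<in> fobj F_El K"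
    for K L M :: "('a, 'b) field_ext" and f g x
  proof -
    obtain p where p: "p \<in> carrier K \<times> carrier K" "x = curve_iso K `` {p}"
      using rep \<open>x \<in> fobj F_El K\<close> by blast
    have "fmap F_El K M (g \<circ> f) x = curve_iso M `` {map_prod (g \<circ> f) (g \<circ> f) p}"
      using fmap_F_El_class[OF that(1,3) ring_hom_trans[OF that(4,5)] p(1)] p(2) by simp
    moreover have "fmap F_El L M g (fmap F_El K L f x) = curve_iso M `` {map_prod g g (map_prod f f p)}"
      using fmap_F_El_class[OF that(1,2,4) p(1)]
        fmap_F_El_class[OF that(2,3,5) closed[OF that(4) p(1)]] p(2) by simp
    ultimately show ?thesis
      by (cases p) simp
  qed
  show ?thesis
    unfolding covariant_functor_def field_extension_def ext_hom_def
    by (intro conjI allI impI ballI) (use 1 2 3 in auto)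
qed

end

theory Submission
  imports Defs "HOL-Library.Product_Plus"
begin

text \<open>
  A curve with coefficients \<open>a, b \<in> K\<close> is defined over the subfield \<open>k(a, b)\<close>, so the bound
  \<open>\<le> 2\<close> says that a field generated by two elements has transcendence degree at most \<open>2\<close>. This is
  a dimension count (\<open>trdeg_generate_field_le\<close>): after multiplication by a power of a common
  denominator, the monomials with exponents up to \<open>N\<close> in \<open>s\<close> elements of \<open>k(A)\<close> become polynomials
  in \<open>A\<close> with exponents bounded by a constant times \<open>N\<close>. There are \<open>(N + 1)\<^sup>s\<close> of them, in a space
  of dimension of order at most \<open>N\<^sup>r\<close>, where \<open>r\<close> is the number of elements of \<open>A\<close>, so they are
  linearly dependent for large \<open>N\<close> if \<open>s > r\<close>.

  For the bound \<open>\<ge> 2\<close> take the curve with \<open>a = y\<close> and \<open>b = x\<close> over \<open>K = k(x, y)\<close>. The exponents of the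
  leading monomial define a homomorphism \<open>w\<close> from \<open>K\<^sup>*\<close> to \<open>\<int>\<^sup>2\<close> that vanishes on \<open>k\<^sup>*\<close>, and
  nonzero elements with distinct values have nonzero sum. Therefore elements of \<open>K\<close> whose values are
  linearly independent over \<open>\<int>\<close> are algebraically independent over \<open>k\<close>
  (\<open>algebraically_independentI_degree\<close>). An isomorphic curve has coefficients \<open>a l\<^sup>4\<close> and \<open>b l\<^sup>6\<close>; with
  \<open>w l = (p, q)\<close> their values are \<open>(1 + 4 p, 4 q)\<close> and \<open>(6 p, 1 + 6 q)\<close>, and the determinant
  \<open>1 + 4 p + 6 q\<close> is odd, hence nonzero. So every field over which the curve can be defined contains
  two algebraically independent elements.

  The field \<open>K\<close> must live in the type \<open>'b\<close>. Since \<open>k\<close> is infinite, \<open>k(x, y)\<close> has the same cardinality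
  as \<open>k\<close>, and it is transported along an injection.
\<close>

section \<open>Degree maps\<close>

text \<open>
  The second clause replaces an order on the value group: among terms with pairwise distinct degrees
  one dominates and cannot be cancelled. Stated in this form the values may lie in any abelian group,
  so pairs of degrees need no lexicographic order.
\<close>

definition degree_map :: "('c, 'm) ring_scheme \<Rightarrow> ('c \<Rightarrow> 'g::ab_group_add) \<Rightarrow> bool" where
  "degree_map R w \<longleftrightarrow>
     (\<forall>x\<in>carrier R - {\<zero>\<^bsub>R\<^esub>}. \<forall>y\<in>carrier R - {\<zero>\<^bsub>R\<^esub>}. w (x \<otimes>\<^bsub>R\<^esub> y) = w x + w y) \<and>
     (\<forall>F\<subseteq>carrier R - {\<zero>\<^bsub>R\<^esub>}. finite F \<longrightarrow> F \<noteq> {} \<longrightarrow> inj_on w F \<longrightarrow>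
        (\<Oplus>\<^bsub>R\<^esub>x\<in>F. x) \<noteq> \<zero>\<^bsub>R\<^esub>)"

lemma degree_map_mult:
  assumes "degree_map R w" "x \<in> carrier R - {\<zero>\<^bsub>R\<^esub>}" "y \<in> carrier R - {\<zero>\<^bsub>R\<^esub>}"
  shows "w (x \<otimes>\<^bsub>R\<^esub> y) = w x + w y"
  using assms by (simp add: degree_map_def)

lemma (in ring) degree_map_finsum_nonzero:
  assumes w: "degree_map R w" and I: "finite I" "I \<noteq> {}"
    and f: "f \<in> I \<rightarrow> carrier R - {\<zero>}" and inj: "inj_on (\<lambda>i. w (f i)) I"
  shows "(\<Oplus>i\<in>I. f i) \<noteq> \<zero>"
proof -
  have "inj_on f I"
    using inj by (auto simp: inj_on_def)
  moreover have "inj_on w (f ` I)"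
    using inj by (auto simp: inj_on_def)
  moreover have "f ` I \<subseteq> carrier R - {\<zero>}"
    using f by auto
  ultimately have "(\<Oplus>x\<in>f ` I. x) \<noteq> \<zero>"
    using w I unfolding degree_map_def by blast
  moreover have "(\<Oplus>x\<in>f ` I. x) = (\<Oplus>i\<in>I. f i)"
    using f by (intro finsum_reindex \<open>inj_on f I\<close>) auto
  ultimately show ?thesis by simp
qed

lemma (in domain) degree_map_one:
  assumes "degree_map R w" shows "w \<one> = 0"
  using degree_map_mult[OF assms, of \<one> \<one>] by simp

lemma (in ring) degree_map_trivial: "degree_map R (\<lambda>_. 0)"
  unfolding degree_map_def
proof (intro conjI ballI allI impI)
  fix F assume F: "F \<subseteq> carrier R - {\<zero>}" "finite F" "F \<noteq> {}" "inj_on (\<lambda>_. 0) F"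
  then obtain x where "F = {x}"
    by (auto simp: inj_on_def)
  then show "(\<Oplus>x\<in>F. x) \<noteq> \<zero>"
    using F by simp
qed simp

text \<open>
  Used to carry a degree map along an isomorphism to a field in another type.
\<close>

lemma degree_map_pullback:
  assumes w: "degree_map S w" and h: "ring_hom_ring R S h" and inj: "inj_on h (carrier R)"
  shows "degree_map R (\<lambda>x. w (h x))"
proof -
  interpret h: ring_hom_ring R S h by fact
  have nz: "h x \<in> carrier S - {\<zero>\<^bsub>S\<^esub>}" if "x \<in> carrier R - {\<zero>\<^bsub>R\<^esub>}" for x
    using that inj_onD[OF inj, of x "\<zero>\<^bsub>R\<^esub>"] by auto
  have hs: "h (\<Oplus>\<^bsub>R\<^esub>x\<in>F. x) = (\<Oplus>\<^bsub>S\<^esub>x\<in>F. h x)" if "finite F" "F \<subseteq> carrier R" for F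
    using that
  proof (induction F rule: finite_induct)
    case (insert x F)
    then have "h ` insert x F \<subseteq> carrier S" by auto
    with insert show ?case by (simp add: Pi_def subset_iff)
  qed simp
  show ?thesis
    unfolding degree_map_def
  proof (intro conjI ballI allI impI)
    fix x y assume "x \<in> carrier R - {\<zero>\<^bsub>R\<^esub>}" "y \<in> carrier R - {\<zero>\<^bsub>R\<^esub>}"
    then show "w (h (x \<otimes>\<^bsub>R\<^esub> y)) = w (h x) + w (h y)"
      using degree_map_mult[OF w nz nz] by simp
  next
    fix F assume F: "F \<subseteq> carrier R - {\<zero>\<^bsub>R\<^esub>}" "finite F" "F \<noteq> {}" "inj_on (\<lambda>x. w (h x)) F"
    then have "(\<Oplus>\<^bsub>S\<^esub>x\<in>F. h x) \<noteq> \<zero>\<^bsub>S\<^esub>"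
      using nz by (intro h.S.degree_map_finsum_nonzero[OF w]) auto
    then show "(\<Oplus>\<^bsub>R\<^esub>x\<in>F. x) \<noteq> \<zero>\<^bsub>R\<^esub>"
      using hs[of F] F by force
  qed
qed

section \<open>Degrees of polynomials\<close>

text \<open>
  Iterating this construction gives the exponents of the lexicographically leading monomial of a
  polynomial in several variables.
\<close>

definition UP_degree ::
  "('c, 'm) ring_scheme \<Rightarrow> ('c \<Rightarrow> 'g) \<Rightarrow> (nat \<Rightarrow> 'c) \<Rightarrow> int \<times> 'g" where
  "UP_degree R w p = (int (deg R p), w (up_ring.coeff (UP R) p (deg R p)))"

lemma (in UP_domain) lcoeff_mult:
  assumes R: "p \<in> carrier P" "q \<in> carrier P"
  shows "up_ring.coeff P (p \<otimes>\<^bsub>P\<^esub> q) (deg R p + deg R q) =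
    up_ring.coeff P p (deg R p) \<otimes> up_ring.coeff P q (deg R q)"
proof -
  let ?n = "deg R p + deg R q" and ?c = "up_ring.coeff P p (deg R p) \<otimes> up_ring.coeff P q (deg R q)"
  have eq: "up_ring.coeff P p i \<otimes> up_ring.coeff P q (?n - i) = (if deg R p = i then ?c else \<zero>)" for i
  proof (cases i "deg R p" rule: linorder_cases)
    case less
    then have "up_ring.coeff P q (?n - i) = \<zero>"
      using R by (intro deg_aboveD) auto
    then show ?thesis using less R by simp
  next
    case greater
    then have "up_ring.coeff P p i = \<zero>"
      using R by (intro deg_aboveD) auto
    then show ?thesis using greater R by simp
  qed simp
  have "up_ring.coeff P (p \<otimes>\<^bsub>P\<^esub> q) ?n = (\<Oplus>i\<in>{..?n}. if deg R p = i then ?c else \<zero>)"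
    using R by (simp add: eq)
  also have "\<dots> = ?c"
    using R by (intro R.finsum_singleton) auto
  finally show ?thesis .
qed

text \<open>
  Let \<open>n\<close> be the largest degree that occurs in a sum. Only the summands of degree \<open>n\<close> contribute to
  the coefficient at \<open>n\<close>; they share the first component of their value, so their leading
  coefficients have distinct values and the coefficient is a nonzero sum.
\<close>

lemma (in UP_domain) degree_map_UP_degree:
  assumes w: "degree_map R w"
  shows "degree_map P (UP_degree R w)"
proof -
  let ?lc = "\<lambda>p. up_ring.coeff P p (deg R p)"
  have W: "UP_degree R w p = (int (deg R p), w (?lc p))" for p
    by (simp add: UP_degree_def P_def)
  have lc: "?lc p \<in> carrier R - {\<zero>}" if "p \<in> carrier P - {\<zero>\<^bsub>P\<^esub>}" for p
    using that lcoeff_nonzero[of p] by auto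
  show ?thesis
    unfolding degree_map_def
  proof (intro conjI ballI allI impI)
    fix p q assume pq: "p \<in> carrier P - {\<zero>\<^bsub>P\<^esub>}" "q \<in> carrier P - {\<zero>\<^bsub>P\<^esub>}"
    then show "UP_degree R w (p \<otimes>\<^bsub>P\<^esub> q) = UP_degree R w p + UP_degree R w q"
      using degree_map_mult[OF w lc lc] lcoeff_mult[of p q] by (simp add: W del: coeff_mult)
  next
    fix F assume F: "F \<subseteq> carrier P - {\<zero>\<^bsub>P\<^esub>}" "finite F" "F \<noteq> {}" "inj_on (UP_degree R w) F"
    define n where "n = Max (deg R ` F)"
    define G where "G = {p\<in>F. deg R p = n}"
    have G: "finite G" "G \<noteq> {}" "G \<subseteq> F"
      using F Max_in[of "deg R ` F"] by (auto simp: G_def n_def image_iff)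
    have le: "deg R p \<le> n" if "p \<in> F" for p
      using F that by (simp add: n_def)
    have FP: "up_ring.coeff P p i \<in> carrier R" if "p \<in> F" for p i
      using that F by auto
    have "up_ring.coeff P (\<Oplus>\<^bsub>P\<^esub>p\<in>F. p) n = (\<Oplus>p\<in>F. up_ring.coeff P p n)"
      using F by (intro coeff_finsum) auto
    also have "\<dots> = (\<Oplus>p\<in>G. up_ring.coeff P p n)"
    proof (intro R.add.finprod_mono_neutral_cong_right)
      fix p assume "p \<in> F - G"
      then have "deg R p < n"
        using le[of p] by (auto simp: G_def)
      then show "up_ring.coeff P p n = \<zero>"
        using F \<open>p \<in> F - G\<close> by (intro deg_aboveD) auto
    qed (use F G FP in auto)
    also have "\<dots> = (\<Oplus>p\<in>G. ?lc p)"
      using G FP by (intro R.finsum_cong') (auto simp: G_def)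
    also have "\<dots> \<noteq> \<zero>"
    proof (rule R.degree_map_finsum_nonzero[OF w \<open>finite G\<close> \<open>G \<noteq> {}\<close>])
      show "inj_on (\<lambda>p. w (?lc p)) G"
        using F(4) G(3) by (auto simp: inj_on_def W G_def)
    qed (use lc F G in blast)
    finally show "(\<Oplus>\<^bsub>P\<^esub>p\<in>F. p) \<noteq> \<zero>\<^bsub>P\<^esub>"
      by auto
  qed
qed

section \<open>Fraction fields\<close>

text \<open>
  A fraction is the set of all pairs that represent it, so equal fractions are equal sets.
\<close>

definition fraction :: "('c, 'm) ring_scheme \<Rightarrow> 'c \<Rightarrow> 'c \<Rightarrow> ('c \<times> 'c) set" where
  "fraction R p q =
     {(x, y). x \<in> carrier R \<and> y \<in> carrier R - {\<zero>\<^bsub>R\<^esub>} \<and> x \<otimes>\<^bsub>R\<^esub> q = p \<otimes>\<^bsub>R\<^esub> y}"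

definition numerator :: "('c \<times> 'c) set \<Rightarrow> 'c" where
  "numerator u = fst (SOME z. z \<in> u)"

definition denominator :: "('c \<times> 'c) set \<Rightarrow> 'c" where
  "denominator u = snd (SOME z. z \<in> u)"

text \<open>
  The operations act on representatives picked by \<^const>\<open>numerator\<close> and \<^const>\<open>denominator\<close>;
  \<open>fraction_mult\<close> and \<open>fraction_add\<close> below show that the choice does not matter.
\<close>

definition fraction_field :: "('c, 'm) ring_scheme \<Rightarrow> ('c \<times> 'c) set ring" where
  "fraction_field R = ring.make
     ((\<lambda>(p, q). fraction R p q) ` (carrier R \<times> (carrier R - {\<zero>\<^bsub>R\<^esub>})))
     (\<lambda>u v. fraction R (numerator u \<otimes>\<^bsub>R\<^esub> numerator v) (denominator u \<otimes>\<^bsub>R\<^esub> denominator v))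
     (fraction R \<one>\<^bsub>R\<^esub> \<one>\<^bsub>R\<^esub>)
     (fraction R \<zero>\<^bsub>R\<^esub> \<one>\<^bsub>R\<^esub>)
     (\<lambda>u v. fraction R (numerator u \<otimes>\<^bsub>R\<^esub> denominator v \<oplus>\<^bsub>R\<^esub> numerator v \<otimes>\<^bsub>R\<^esub> denominator u)
        (denominator u \<otimes>\<^bsub>R\<^esub> denominator v))"

context domain
begin

lemma fraction_mem:
  assumes "p \<in> carrier R" "q \<in> carrier R - {\<zero>}"
  shows "(p, q) \<in> fraction R p q"
  using assms by (auto simp: fraction_def)

text \<open>
  Transitivity of the equality of fractions, which is where cancellation in the domain enters.
\<close>

lemma fraction_trans:
  assumes "p \<in> carrier R" "q \<in> carrier R" "r \<in> carrier R" "s \<in> carrier R - {\<zero>}"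
    "x \<in> carrier R" "y \<in> carrier R" "p \<otimes> s = r \<otimes> q" "x \<otimes> s = r \<otimes> y"
  shows "x \<otimes> q = p \<otimes> y"
proof -
  have "s \<otimes> (x \<otimes> q) = (x \<otimes> s) \<otimes> q"
    using assms(1-6) by (simp add: m_ac)
  also have "\<dots> = (r \<otimes> q) \<otimes> y"
    unfolding assms(8) using assms(1-6) by (simp add: m_ac)
  also have "\<dots> = (p \<otimes> s) \<otimes> y"
    using assms(7) by simp
  also have "\<dots> = s \<otimes> (p \<otimes> y)"
    using assms(1-6) by (simp add: m_ac)
  finally show ?thesis
    using assms m_lcancel[of s] by auto
qed

lemma fraction_eq_iff:
  assumes "p \<in> carrier R" "q \<in> carrier R - {\<zero>}" "r \<in> carrier R" "s \<in> carrier R - {\<zero>}"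
  shows "fraction R p q = fraction R r s \<longleftrightarrow> p \<otimes> s = r \<otimes> q"
proof
  assume "fraction R p q = fraction R r s"
  then show "p \<otimes> s = r \<otimes> q"
    using fraction_mem[OF assms(1,2)] by (auto simp: fraction_def)
next
  assume eq: "p \<otimes> s = r \<otimes> q"
  have "x \<otimes> q = p \<otimes> y \<longleftrightarrow> x \<otimes> s = r \<otimes> y" if "x \<in> carrier R" "y \<in> carrier R" for x y
    using fraction_trans[of p q r s x y] fraction_trans[of r s p q x y] assms eq that by auto
  then show "fraction R p q = fraction R r s"
    by (auto simp: fraction_def)
qed

lemma numerator_denominator:
  assumes "p \<in> carrier R" "q \<in> carrier R - {\<zero>}"
  shows "numerator (fraction R p q) \<in> carrier R" "denominator (fraction R p q) \<in> carrier R - {\<zero>}"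
    "numerator (fraction R p q) \<otimes> q = p \<otimes> denominator (fraction R p q)"
proof -
  have "(SOME z. z \<in> fraction R p q) \<in> fraction R p q"
    by (rule someI) (rule fraction_mem[OF assms])
  then show "numerator (fraction R p q) \<in> carrier R" "denominator (fraction R p q) \<in> carrier R - {\<zero>}"
    "numerator (fraction R p q) \<otimes> q = p \<otimes> denominator (fraction R p q)"
    by (auto simp: numerator_def denominator_def fraction_def)
qed

lemma fraction_carrier:
  assumes "p \<in> carrier R" "q \<in> carrier R - {\<zero>}"
  shows "fraction R p q \<in> carrier (fraction_field R)"
  using assms by (auto simp: fraction_field_def ring.defs)

lemma fraction_cases:
  assumes "u \<in> carrier (fraction_field R)"
  obtains p q where "p \<in> carrier R" "q \<in> carrier R - {\<zero>}" "u = fraction R p q"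
  using assms by (auto simp: fraction_field_def ring.defs)

lemma fraction_mult:
  assumes "p \<in> carrier R" "q \<in> carrier R - {\<zero>}" "r \<in> carrier R" "s \<in> carrier R - {\<zero>}"
  shows "fraction R p q \<otimes>\<^bsub>fraction_field R\<^esub> fraction R r s = fraction R (p \<otimes> r) (q \<otimes> s)"
proof -
  define a b c d where "a = numerator (fraction R p q)" "b = denominator (fraction R p q)"
    "c = numerator (fraction R r s)" "d = denominator (fraction R r s)"
  note abcd = numerator_denominator[OF assms(1,2)] numerator_denominator[OF assms(3,4)]
  have in_R: "a \<in> carrier R" "b \<in> carrier R" "b \<noteq> \<zero>" "c \<in> carrier R" "d \<in> carrier R" "d \<noteq> \<zero>"
    and eq: "a \<otimes> q = p \<otimes> b" "c \<otimes> s = r \<otimes> d"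
    using abcd by (auto simp: a_b_c_d_def)
  have "a \<otimes> c \<otimes> (q \<otimes> s) = (a \<otimes> q) \<otimes> (c \<otimes> s)"
    using in_R assms by (simp add: m_ac)
  also have "\<dots> = p \<otimes> r \<otimes> (b \<otimes> d)"
    unfolding eq using in_R assms by (simp add: m_ac)
  finally have "fraction R (a \<otimes> c) (b \<otimes> d) = fraction R (p \<otimes> r) (q \<otimes> s)"
    using in_R assms by (subst fraction_eq_iff) (auto simp: integral_iff)
  then show ?thesis
    by (simp add: fraction_field_def ring.defs a_b_c_d_def)
qed

lemma fraction_add:
  assumes "p \<in> carrier R" "q \<in> carrier R - {\<zero>}" "r \<in> carrier R" "s \<in> carrier R - {\<zero>}"
  shows "fraction R p q \<oplus>\<^bsub>fraction_field R\<^esub> fraction R r s = fraction R (p \<otimes> s \<oplus> r \<otimes> q) (q \<otimes> s)"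
proof -
  define a b c d where "a = numerator (fraction R p q)" "b = denominator (fraction R p q)"
    "c = numerator (fraction R r s)" "d = denominator (fraction R r s)"
  note abcd = numerator_denominator[OF assms(1,2)] numerator_denominator[OF assms(3,4)]
  have in_R: "a \<in> carrier R" "b \<in> carrier R" "b \<noteq> \<zero>" "c \<in> carrier R" "d \<in> carrier R" "d \<noteq> \<zero>"
    and eq: "a \<otimes> q = p \<otimes> b" "c \<otimes> s = r \<otimes> d"
    using abcd by (auto simp: a_b_c_d_def)
  have "(a \<otimes> d \<oplus> c \<otimes> b) \<otimes> (q \<otimes> s) = (a \<otimes> q) \<otimes> (d \<otimes> s) \<oplus> (c \<otimes> s) \<otimes> (b \<otimes> q)"
    using in_R assms by (simp add: m_ac l_distr r_distr)
  also have "\<dots> = (p \<otimes> s \<oplus> r \<otimes> q) \<otimes> (b \<otimes> d)"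
    unfolding eq using in_R assms by (simp add: m_ac l_distr r_distr)
  finally have "fraction R (a \<otimes> d \<oplus> c \<otimes> b) (b \<otimes> d) = fraction R (p \<otimes> s \<oplus> r \<otimes> q) (q \<otimes> s)"
    using in_R assms by (subst fraction_eq_iff) (auto simp: integral_iff)
  then show ?thesis
    by (simp add: fraction_field_def ring.defs a_b_c_d_def)
qed

lemma fraction_field_zero_one:
  "\<zero>\<^bsub>fraction_field R\<^esub> = fraction R \<zero> \<one>" "\<one>\<^bsub>fraction_field R\<^esub> = fraction R \<one> \<one>"
  by (simp_all add: fraction_field_def ring.defs)

lemmas fraction_simps =
  fraction_mult fraction_add fraction_field_zero_one fraction_eq_iff fraction_carrier integral_iff

lemma fraction_cases_nonzero:
  assumes "u \<in> carrier (fraction_field R) - {\<zero>\<^bsub>fraction_field R\<^esub>}"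
  obtains p q where "p \<in> carrier R - {\<zero>}" "q \<in> carrier R - {\<zero>}" "u = fraction R p q"
proof -
  obtain p q where u: "p \<in> carrier R" "q \<in> carrier R - {\<zero>}" "u = fraction R p q"
    using assms by (auto elim!: fraction_cases)
  moreover have "p \<noteq> \<zero>"
    using u assms by (auto simp: fraction_simps)
  ultimately show ?thesis
    using that by auto
qed

lemma field_fraction_field: "field (fraction_field R)"
proof -
  have reps: "\<exists>p q. p \<in> carrier R \<and> q \<in> carrier R \<and> q \<noteq> \<zero> \<and> u = fraction R p q"
    if "u \<in> carrier (fraction_field R)" for u
    using that by (auto elim!: fraction_cases)
  have "cring (fraction_field R)"
  proof (intro cringI abelian_groupI comm_monoidI)
    fix u v w assume "u \<in> carrier (fraction_field R)" "v \<in> carrier (fraction_field R)"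
      "w \<in> carrier (fraction_field R)"
    then obtain p q r s x y where in_R: "p \<in> carrier R" "q \<in> carrier R" "q \<noteq> \<zero>"
        "r \<in> carrier R" "s \<in> carrier R" "s \<noteq> \<zero>" "x \<in> carrier R" "y \<in> carrier R" "y \<noteq> \<zero>"
      and uvw: "u = fraction R p q" "v = fraction R r s" "w = fraction R x y"
      using reps by metis
    note arith = fraction_simps m_ac a_ac l_distr r_distr
    show "u \<oplus>\<^bsub>fraction_field R\<^esub> v \<oplus>\<^bsub>fraction_field R\<^esub> w =
        u \<oplus>\<^bsub>fraction_field R\<^esub> (v \<oplus>\<^bsub>fraction_field R\<^esub> w)"
      unfolding uvw using in_R by (simp add: arith)
    show "u \<otimes>\<^bsub>fraction_field R\<^esub> v \<otimes>\<^bsub>fraction_field R\<^esub> w =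
        u \<otimes>\<^bsub>fraction_field R\<^esub> (v \<otimes>\<^bsub>fraction_field R\<^esub> w)"
      unfolding uvw using in_R by (simp add: arith)
    show "(u \<oplus>\<^bsub>fraction_field R\<^esub> v) \<otimes>\<^bsub>fraction_field R\<^esub> w =
        u \<otimes>\<^bsub>fraction_field R\<^esub> w \<oplus>\<^bsub>fraction_field R\<^esub> v \<otimes>\<^bsub>fraction_field R\<^esub> w"
      unfolding uvw using in_R by (simp add: arith)
  next
    fix u v assume "u \<in> carrier (fraction_field R)" "v \<in> carrier (fraction_field R)"
    then obtain p q r s where in_R: "p \<in> carrier R" "q \<in> carrier R" "q \<noteq> \<zero>"
        "r \<in> carrier R" "s \<in> carrier R" "s \<noteq> \<zero>" and uv: "u = fraction R p q" "v = fraction R r s"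
      using reps by metis
    show "u \<oplus>\<^bsub>fraction_field R\<^esub> v \<in> carrier (fraction_field R)"
      "u \<otimes>\<^bsub>fraction_field R\<^esub> v \<in> carrier (fraction_field R)"
      unfolding uv using in_R by (simp_all add: fraction_simps)
    show "u \<oplus>\<^bsub>fraction_field R\<^esub> v = v \<oplus>\<^bsub>fraction_field R\<^esub> u"
      "u \<otimes>\<^bsub>fraction_field R\<^esub> v = v \<otimes>\<^bsub>fraction_field R\<^esub> u"
      unfolding uv using in_R by (simp_all add: fraction_simps m_ac a_ac)
  next
    fix u assume "u \<in> carrier (fraction_field R)"
    then obtain p q where in_R: "p \<in> carrier R" "q \<in> carrier R" "q \<noteq> \<zero>" and u: "u = fraction R p q"
      using reps by metis
    show "\<zero>\<^bsub>fraction_field R\<^esub> \<oplus>\<^bsub>fraction_field R\<^esub> u = u" "\<one>\<^bsub>fraction_field R\<^esub> \<otimes>\<^bsub>fraction_field R\<^esub> u = u"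
      unfolding u using in_R by (simp_all add: fraction_simps)
    show "\<exists>v\<in>carrier (fraction_field R). v \<oplus>\<^bsub>fraction_field R\<^esub> u = \<zero>\<^bsub>fraction_field R\<^esub>"
      unfolding u using in_R
      by (intro bexI[of _ "fraction R (\<ominus> p) q"]) (simp_all add: fraction_simps l_minus l_neg)
  qed (simp_all add: fraction_simps)
  then show ?thesis
  proof (rule cring.cring_fieldI2)
    show "\<zero>\<^bsub>fraction_field R\<^esub> \<noteq> \<one>\<^bsub>fraction_field R\<^esub>"
      by (simp add: fraction_simps)
  next
    fix u assume "u \<in> carrier (fraction_field R)" "u \<noteq> \<zero>\<^bsub>fraction_field R\<^esub>"
    then obtain p q where "p \<in> carrier R - {\<zero>}" "q \<in> carrier R - {\<zero>}" "u = fraction R p q"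
      using fraction_cases_nonzero[of u] by blast
    then show "\<exists>v\<in>carrier (fraction_field R). u \<otimes>\<^bsub>fraction_field R\<^esub> v = \<one>\<^bsub>fraction_field R\<^esub>"
      by (intro bexI[of _ "fraction R q p"]) (auto simp: fraction_simps m_comm)
  qed
qed

lemma ring_hom_fraction: "(\<lambda>p. fraction R p \<one>) \<in> ring_hom R (fraction_field R)"
  by (intro ring_hom_memI) (auto simp: fraction_simps)

definition fraction_degree :: "('a \<Rightarrow> 'g::ab_group_add) \<Rightarrow> ('a \<times> 'a) set \<Rightarrow> 'g" where
  "fraction_degree w u = w (numerator u) - w (denominator u)"

lemma fraction_degree_fraction:
  assumes w: "degree_map R w" and pq: "p \<in> carrier R - {\<zero>}" "q \<in> carrier R - {\<zero>}"
  shows "fraction_degree w (fraction R p q) = w p - w q"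
proof -
  define a b where "a = numerator (fraction R p q)" "b = denominator (fraction R p q)"
  have ab: "a \<in> carrier R" "b \<in> carrier R - {\<zero>}" "a \<otimes> q = p \<otimes> b"
    using pq numerator_denominator[of p q] by (auto simp: a_b_def)
  then have "a \<noteq> \<zero>"
    using pq integral_iff[of p b] by auto
  then have "w a + w q = w p + w b"
    using ab pq degree_map_mult[OF w, of a q] degree_map_mult[OF w, of p b] by simp
  then show ?thesis
    by (simp add: fraction_degree_def a_b_def[symmetric] algebra_simps)
qed

lemma fraction_common_denominator:
  assumes "finite F" "F \<subseteq> carrier (fraction_field R)"
  shows "\<exists>d\<in>carrier R - {\<zero>}. \<forall>u\<in>F. \<exists>p\<in>carrier R. u = fraction R p d"
  using assms
proof (induction F rule: finite_induct)
  case empty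
  show ?case by (intro bexI[of _ \<one>]) auto
next
  case (insert u F)
  then obtain d where d: "d \<in> carrier R - {\<zero>}" "\<forall>v\<in>F. \<exists>p\<in>carrier R. v = fraction R p d"
    by auto
  obtain p q where u: "p \<in> carrier R" "q \<in> carrier R - {\<zero>}" "u = fraction R p q"
    using insert.prems by (auto elim!: fraction_cases)
  have "\<exists>r\<in>carrier R. v = fraction R r (q \<otimes> d)" if "v \<in> insert u F" for v
  proof (cases "v = u")
    case True
    then show ?thesis
      using u d by (intro bexI[of _ "p \<otimes> d"]) (auto simp: fraction_simps m_ac)
  next
    case False
    then obtain r where "r \<in> carrier R" "v = fraction R r d"
      using d \<open>v \<in> insert u F\<close> by auto
    then show ?thesis
      using u d by (intro bexI[of _ "q \<otimes> r"]) (auto simp: fraction_simps m_ac)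
  qed
  then show ?case
    using u d by (intro bexI[of _ "q \<otimes> d"]) (auto simp: integral_iff)
qed

lemma fraction_finsum:
  assumes "finite I" "p \<in> I \<rightarrow> carrier R" "d \<in> carrier R - {\<zero>}"
  shows "(\<Oplus>\<^bsub>fraction_field R\<^esub>i\<in>I. fraction R (p i) d) = fraction R (\<Oplus>i\<in>I. p i) d"
proof -
  interpret Q: field "fraction_field R" by (rule field_fraction_field)
  show ?thesis
    using assms(1,2)
  proof (induction I rule: finite_induct)
    case empty
    show ?case using assms(3) by (simp add: fraction_simps)
  next
    case (insert i I)
    then have "(\<Oplus>i\<in>I. p i) \<in> carrier R" "p i \<in> carrier R"
      by auto
    with insert show ?case
      using assms(3) by (simp add: fraction_simps Pi_def l_distr r_distr m_ac)
  qed
qed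

text \<open>
  Over a common denominator \<open>d\<close>, which shifts all values by the same amount, the sum of fractions
  becomes a sum in the domain.
\<close>

lemma degree_map_fraction_degree:
  assumes w: "degree_map R w"
  shows "degree_map (fraction_field R) (fraction_degree w)"
proof -
  interpret Q: field "fraction_field R" by (rule field_fraction_field)
  show ?thesis
    unfolding degree_map_def
  proof (intro conjI ballI allI impI)
    fix u v assume u: "u \<in> carrier (fraction_field R) - {\<zero>\<^bsub>fraction_field R\<^esub>}"
      and v: "v \<in> carrier (fraction_field R) - {\<zero>\<^bsub>fraction_field R\<^esub>}"
    obtain p q where pq: "u = fraction R p q" "p \<in> carrier R - {\<zero>}" "q \<in> carrier R - {\<zero>}"
      using fraction_cases_nonzero[OF u] by metis
    obtain r s where rs: "v = fraction R r s" "r \<in> carrier R - {\<zero>}" "s \<in> carrier R - {\<zero>}"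
      using fraction_cases_nonzero[OF v] by metis
    note uv = pq(1) rs(1) and in_R = pq(2,3) rs(2,3)
    have "p \<otimes> r \<in> carrier R - {\<zero>}" "q \<otimes> s \<in> carrier R - {\<zero>}"
      using in_R by (auto simp: integral_iff)
    then show "fraction_degree w (u \<otimes>\<^bsub>fraction_field R\<^esub> v) = fraction_degree w u + fraction_degree w v"
      unfolding uv using in_R
      by (simp add: fraction_mult fraction_degree_fraction[OF w] degree_map_mult[OF w])
  next
    fix F assume F: "F \<subseteq> carrier (fraction_field R) - {\<zero>\<^bsub>fraction_field R\<^esub>}" "finite F" "F \<noteq> {}"
      "inj_on (fraction_degree w) F"
    then obtain d where d: "d \<in> carrier R - {\<zero>}" "\<forall>u\<in>F. \<exists>p\<in>carrier R. u = fraction R p d"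
      using fraction_common_denominator[of F] by blast
    then obtain p where p: "p u \<in> carrier R" "u = fraction R (p u) d" if "u \<in> F" for u
      by metis
    have nz: "p u \<noteq> \<zero>" if "u \<in> F" for u
    proof
      assume "p u = \<zero>"
      then have "u = \<zero>\<^bsub>fraction_field R\<^esub>"
        using p[OF that] d by (simp add: fraction_simps)
      then show False using F that by blast
    qed
    have "(\<Oplus>u\<in>F. p u) \<noteq> \<zero>"
    proof (rule degree_map_finsum_nonzero[OF w F(2,3)])
      have "fraction_degree w u = w (p u) - w d" if "u \<in> F" for u
        using fraction_degree_fraction[OF w, of "p u" d] p[OF that] nz[OF that] d by simp
      then show "inj_on (\<lambda>u. w (p u)) F"
        using F(4) by (simp add: inj_on_def)
    qed (use p nz in auto)
    moreover have "(\<Oplus>\<^bsub>fraction_field R\<^esub>u\<in>F. u) = (\<Oplus>\<^bsub>fraction_field R\<^esub>u\<in>F. fraction R (p u) d)"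
    proof (rule Q.finsum_cong')
      show "(\<lambda>u. fraction R (p u) d) \<in> F \<rightarrow> carrier (fraction_field R)"
        using p d by (auto intro: fraction_carrier)
    qed (use p in auto)
    moreover have "(\<Oplus>u\<in>F. p u) \<in> carrier R"
      using p by (intro finsum_closed) auto
    ultimately show "(\<Oplus>\<^bsub>fraction_field R\<^esub>u\<in>F. u) \<noteq> \<zero>\<^bsub>fraction_field R\<^esub>"
      using fraction_finsum[of F p d] F p d by (simp add: fraction_simps Pi_def)
  qed
qed

end

section \<open>Monomials and indexed polynomials\<close>

definition monomial :: "('b, 'n) ring_scheme \<Rightarrow> 'b multiset \<Rightarrow> 'b" where
  "monomial R m = (\<Otimes>\<^bsub>R\<^esub>x\<in>set_mset m. x [^]\<^bsub>R\<^esub> count m x)"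

lemma (in cring) monomial_empty [simp]: "monomial R {#} = \<one>"
  by (simp add: monomial_def)

lemma (in cring) monomial_closed:
  assumes "set_mset m \<subseteq> carrier R"
  shows "monomial R m \<in> carrier R"
  unfolding monomial_def using assms by (intro finprod_closed) auto

lemma (in cring) monomial_add_mset:
  assumes "x \<in> carrier R" "set_mset m \<subseteq> carrier R"
  shows "monomial R (add_mset x m) = x \<otimes> monomial R m"
proof -
  define T where "T = set_mset m - {x}"
  define t where "t = (\<Otimes>y\<in>T. y [^] count m y)"
  have T: "finite T" "x \<notin> T" "T \<subseteq> carrier R"
    using assms by (auto simp: T_def)
  have t: "t \<in> carrier R"
    unfolding t_def using T by (intro finprod_closed) auto
  have "monomial R (add_mset x m) = (\<Otimes>y\<in>insert x T. y [^] count (add_mset x m) y)"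
    unfolding monomial_def by (simp add: T_def)
  also have "\<dots> = x [^] count (add_mset x m) x \<otimes> (\<Otimes>y\<in>T. y [^] count (add_mset x m) y)"
    using T assms by (intro finprod_insert) auto
  also have "(\<Otimes>y\<in>T. y [^] count (add_mset x m) y) = t"
    unfolding t_def using T by (intro finprod_cong') auto
  also have "x [^] count (add_mset x m) x \<otimes> t = x \<otimes> (x [^] count m x \<otimes> t)"
    using assms t by (simp add: m_ac)
  also have "x [^] count m x \<otimes> t = (\<Otimes>y\<in>insert x T. y [^] count m y)"
    unfolding t_def using T assms by (intro finprod_insert[symmetric]) auto
  also have "\<dots> = monomial R m"
  proof (cases "x \<in># m")
    case True
    then show ?thesis by (simp add: monomial_def T_def insert_absorb)
  next
    case False
    then have "count m x = 0" "T = set_mset m"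
      by (auto simp: T_def not_in_iff)
    moreover have "(\<Otimes>y\<in>insert x T. y [^] count m y) = x [^] count m x \<otimes> t"
      unfolding t_def using T assms by (intro finprod_insert) auto
    ultimately show ?thesis
      using t by (simp add: monomial_def t_def)
  qed
  finally show ?thesis .
qed

lemma (in cring) monomial_union:
  assumes "set_mset m \<subseteq> carrier R" "set_mset n \<subseteq> carrier R"
  shows "monomial R (m + n) = monomial R m \<otimes> monomial R n"
  using assms
proof (induction m)
  case (add x m)
  then show ?case
    using monomial_closed[of m] monomial_closed[of n] by (simp add: monomial_add_mset m_assoc)
qed (simp add: monomial_closed)

lemma (in domain) degree_monomial:
  assumes w: "degree_map R w" and m: "set_mset m \<subseteq> carrier R - {\<zero>}"
  shows "monomial R m \<in> carrier R - {\<zero>}" "w (monomial R m) = (\<Sum>x\<in>#m. w x)"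
proof -
  have "monomial R m \<in> carrier R - {\<zero>} \<and> w (monomial R m) = (\<Sum>x\<in>#m. w x)"
    using m
  proof (induction m)
    case empty
    show ?case using degree_map_one[OF w] by simp
  next
    case (add x m)
    then have "monomial R (add_mset x m) = x \<otimes> monomial R m"
      by (intro monomial_add_mset) auto
    with add show ?case
      using degree_map_mult[OF w, of x "monomial R m"] by (auto simp: integral_iff)
  qed
  then show "monomial R m \<in> carrier R - {\<zero>}" "w (monomial R m) = (\<Sum>x\<in>#m. w x)"
    by auto
qed

text \<open>
  Together with \<open>indexed_psetI\<close>, this describes the inductively defined set of polynomials in the
  variables \<open>S\<close> as the set of finitely supported coefficient functions on the monomials in \<open>S\<close>.
\<close>

lemma (in ring) indexed_psetD:
  assumes "P \<in> indexed_pset S (carrier R)"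
  shows "finite {m. P m \<noteq> \<zero>}" "P m \<in> carrier R" "P m \<noteq> \<zero> \<Longrightarrow> set_mset m \<subseteq> S"
proof -
  have "finite {m. P m \<noteq> \<zero>} \<and> (\<forall>m. P m \<in> carrier R \<and> (P m \<noteq> \<zero> \<longrightarrow> set_mset m \<subseteq> S))"
    using assms
  proof (induction P)
    case (indexed_const c)
    have "{m. indexed_const c m \<noteq> \<zero>} \<subseteq> {{#}}"
      by (auto simp: indexed_const_def)
    then have "finite {m. indexed_const c m \<noteq> \<zero>}"
      by (rule finite_subset) simp
    then show ?case
      using indexed_const by (simp add: indexed_const_def)
  next
    case (indexed_padd P Q)
    have "{m. indexed_padd P Q m \<noteq> \<zero>} \<subseteq> {m. P m \<noteq> \<zero>} \<union> {m. Q m \<noteq> \<zero>}"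
      by (auto simp: indexed_padd_def)
    then have "finite {m. indexed_padd P Q m \<noteq> \<zero>}"
      by (rule finite_subset) (use indexed_padd in auto)
    moreover have "set_mset m \<subseteq> S" if "indexed_padd P Q m \<noteq> \<zero>" for m
      using that indexed_padd by (cases "P m = \<zero>") (auto simp: indexed_padd_def)
    ultimately show ?case
      using indexed_padd by (simp add: indexed_padd_def)
  next
    case (indexed_pmult P x)
    have sub: "{m. indexed_pmult P x m \<noteq> \<zero>} \<subseteq> add_mset x ` {m. P m \<noteq> \<zero>}"
    proof
      fix m assume "m \<in> {m. indexed_pmult P x m \<noteq> \<zero>}"
      then have "x \<in># m" "P (m - {#x#}) \<noteq> \<zero>"
        by (auto simp: indexed_pmult_def split: if_splits)
      then show "m \<in> add_mset x ` {m. P m \<noteq> \<zero>}"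
        by (intro image_eqI[of _ _ "m - {#x#}"]) auto
    qed
    then have "finite {m. indexed_pmult P x m \<noteq> \<zero>}"
      by (rule finite_subset) (use indexed_pmult in auto)
    moreover have "set_mset m \<subseteq> S" if nz: "indexed_pmult P x m \<noteq> \<zero>" for m
    proof -
      obtain n where "m = add_mset x n" "P n \<noteq> \<zero>"
        using sub nz by blast
      then show ?thesis using indexed_pmult by auto
    qed
    moreover have "indexed_pmult P x m \<in> carrier R" for m
      using indexed_pmult by (auto simp: indexed_pmult_def)
    ultimately show ?case by blast
  qed
  then show "finite {m. P m \<noteq> \<zero>}" "P m \<in> carrier R" "P m \<noteq> \<zero> \<Longrightarrow> set_mset m \<subseteq> S"
    by auto
qed

lemma (in ring) indexed_psetI:
  assumes "finite {m. P m \<noteq> \<zero>}" "\<And>m. P m \<in> carrier R" "\<And>m. P m \<noteq> \<zero> \<Longrightarrow> set_mset m \<subseteq> S"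
  shows "P \<in> indexed_pset S (carrier R)"
proof -
  have single: "(\<lambda>n. if n = m then c else \<zero>) \<in> indexed_pset S (carrier R)"
    if "c \<in> carrier R" "set_mset m \<subseteq> S" for m c
    using that(2)
  proof (induction m)
    case empty
    show ?case
      using indexed_pset.indexed_const[of c] \<open>c \<in> carrier R\<close> by (simp add: indexed_const_def)
  next
    case (add x m)
    let ?Q = "\<lambda>n. if n = m then c else \<zero>"
    have "indexed_pmult ?Q x n = (if n = add_mset x m then c else \<zero>)" for n
    proof (cases "x \<in># n")
      case True
      then obtain n' where "n = add_mset x n'"
        by (blast dest: multi_member_split)
      then show ?thesis by (simp add: indexed_pmult_def)
    next
      case False
      then have "n \<noteq> add_mset x m" by auto
      with False show ?thesis by (simp add: indexed_pmult_def)
    qed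
    then have "indexed_pmult ?Q x = (\<lambda>n. if n = add_mset x m then c else \<zero>)"
      by auto
    moreover have "indexed_pmult ?Q x \<in> indexed_pset S (carrier R)"
      using add by (intro indexed_pset.indexed_pmult) auto
    ultimately show ?case by simp
  qed
  have partial: "(\<lambda>m. if m \<in> F then P m else \<zero>) \<in> indexed_pset S (carrier R)"
    if "finite F" "F \<subseteq> {m. P m \<noteq> \<zero>}" for F
    using that
  proof (induction F rule: finite_induct)
    case empty
    show ?case
      using single[of \<zero> "{#}"] by simp
  next
    case (insert m F)
    let ?Q = "\<lambda>n. if n \<in> F then P n else \<zero>" and ?M = "\<lambda>n. if n = m then P m else \<zero>"
    have "indexed_padd ?M ?Q = (\<lambda>n. if n \<in> insert m F then P n else \<zero>)"
      using insert.hyps assms(2) by (intro ext) (simp add: indexed_padd_def)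
    moreover have "indexed_padd ?M ?Q \<in> indexed_pset S (carrier R)"
      using insert assms by (intro indexed_pset.indexed_padd single) auto
    ultimately show ?case by simp
  qed
  have "(\<lambda>m. if m \<in> {m. P m \<noteq> \<zero>} then P m else \<zero>) = P"
    by auto
  with partial[OF assms(1) order_refl] show ?thesis
    by simp
qed

lemma eval_at_indices_alt:
  "eval_at_indices k K P = (\<Oplus>\<^bsub>K\<^esub>m\<in>{m. P m \<noteq> \<zero>\<^bsub>k\<^esub>}. emb K (P m) \<otimes>\<^bsub>K\<^esub> monomial K m)"
  by (simp add: eval_at_indices_def monomial_def)

section \<open>Algebraic independence\<close>

lemma (in ring_hom_ring) field_hom_inj:
  assumes "field R" "\<one>\<^bsub>S\<^esub> \<noteq> \<zero>\<^bsub>S\<^esub>"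
  shows "inj_on h (carrier R)"
  using img_is_subfield(1)[OF field.carrier_is_subfield[OF assms(1)] assms(2)] .

text \<open>
  Distinct monomials in \<open>S\<close> have distinct values, and nonzero coefficients from \<open>k\<close> do not change
  them. The terms of a nonzero polynomial therefore have distinct values and their sum does not vanish.
\<close>

lemma algebraically_independentI_degree:
  assumes K: "field_extension k K" and w: "degree_map K w"
    and triv: "\<And>c. c \<in> carrier k - {\<zero>\<^bsub>k\<^esub>} \<Longrightarrow> w (emb K c) = 0"
    and S: "S \<subseteq> carrier K - {\<zero>\<^bsub>K\<^esub>}"
    and inj: "inj_on (\<lambda>m. \<Sum>x\<in>#m. w x) {m. set_mset m \<subseteq> S}"
  shows "algebraically_independent k K S"
  unfolding algebraically_independent_def
proof (intro conjI ballI impI)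
  interpret k: field k using K by (simp add: field_extension_def)
  interpret K: field K using K by (simp add: field_extension_def)
  interpret e: ring_hom_ring k K "emb K"
    using K by (intro ring_hom_ringI2 k.ring_axioms K.ring_axioms) (simp add: field_extension_def)
  show "S \<subseteq> carrier K" using S by auto
  fix P assume P: "P \<in> ring.indexed_pset k S (carrier k)" and eval: "eval_at_indices k K P = \<zero>\<^bsub>K\<^esub>"
  let ?T = "{m. P m \<noteq> \<zero>\<^bsub>k\<^esub>}"
  note PD = k.indexed_psetD[OF P]
  have emb: "emb K (P m) \<in> carrier K - {\<zero>\<^bsub>K\<^esub>}" if "m \<in> ?T" for m
    using that PD(2)[of m]
      inj_onD[OF e.field_hom_inj[OF k.field_axioms K.one_not_zero], of "P m" "\<zero>\<^bsub>k\<^esub>"] by auto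
  have mon: "monomial K m \<in> carrier K - {\<zero>\<^bsub>K\<^esub>}" "w (monomial K m) = (\<Sum>x\<in>#m. w x)"
    if "m \<in> ?T" for m
    using K.degree_monomial[OF w, of m] PD(3)[of m] that S by auto
  have "?T = {}"
  proof (rule ccontr)
    assume "?T \<noteq> {}"
    then have "eval_at_indices k K P \<noteq> \<zero>\<^bsub>K\<^esub>"
      unfolding eval_at_indices_alt
    proof (intro K.degree_map_finsum_nonzero[OF w PD(1)])
      show "(\<lambda>m. emb K (P m) \<otimes>\<^bsub>K\<^esub> monomial K m) \<in> ?T \<rightarrow> carrier K - {\<zero>\<^bsub>K\<^esub>}"
        using emb mon by (auto simp: K.integral_iff)
      have val: "w (emb K (P m) \<otimes>\<^bsub>K\<^esub> monomial K m) = (\<Sum>x\<in>#m. w x)" if "m \<in> ?T" for m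
        using degree_map_mult[OF w emb[OF that] mon(1)[OF that]] mon(2)[OF that] triv PD(2) that
        by simp
      show "inj_on (\<lambda>m. w (emb K (P m) \<otimes>\<^bsub>K\<^esub> monomial K m)) ?T"
      proof (rule inj_onI)
        fix m n assume mn: "m \<in> ?T" "n \<in> ?T"
          "w (emb K (P m) \<otimes>\<^bsub>K\<^esub> monomial K m) = w (emb K (P n) \<otimes>\<^bsub>K\<^esub> monomial K n)"
        have "m \<in> {m. set_mset m \<subseteq> S}" "n \<in> {m. set_mset m \<subseteq> S}"
          using mn PD(3) by blast+
        moreover have "(\<Sum>x\<in>#m. w x) = (\<Sum>x\<in>#n. w x)"
          using val[OF mn(1)] val[OF mn(2)] mn(3) by simp
        ultimately show "m = n"
          using inj_onD[OF inj] by blast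
      qed
    qed
    with eval show False by simp
  qed
  then show "P = (\<lambda>_. \<zero>\<^bsub>k\<^esub>)" by auto
qed

text \<open>
  The inclusion of an intermediate field commutes with the evaluation of polynomials.
\<close>

lemma algebraically_independent_restrict:
  assumes K: "field_extension k K" and K0: "intermediate_field k K K0"
  shows "algebraically_independent k (restrict_ext K K0) S \<longleftrightarrow>
    S \<subseteq> K0 \<and> algebraically_independent k K S"
proof -
  interpret k: field k using K by (simp add: field_extension_def)
  interpret K: field K using K by (simp add: field_extension_def)
  have sub: "subfield K0 K" and emb: "emb K ` carrier k \<subseteq> K0"
    using K0 by (auto simp: intermediate_field_def)
  interpret L: field "restrict_ext K K0" by (rule K.subfield_iff(2)[OF sub])
  have K0: "K0 \<subseteq> carrier K" using subfieldE(3)[OF sub] .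
  interpret i: ring_hom_cring "restrict_ext K K0" K "\<lambda>x. x"
    using K0 by unfold_locales (auto simp: ring_hom_def)
  have pow: "x [^]\<^bsub>restrict_ext K K0\<^esub> (n::nat) = x [^]\<^bsub>K\<^esub> n" for x n
    by (simp add: nat_pow_def)
  have mon: "monomial (restrict_ext K K0) m = monomial K m" if "set_mset m \<subseteq> K0" for m
  proof -
    have "x [^]\<^bsub>K\<^esub> n \<in> K0" if "x \<in> K0" for x and n :: nat
      using L.nat_pow_closed[of x n] that by (simp add: pow)
    then have "(\<lambda>x. x [^]\<^bsub>K\<^esub> count m x) \<in> set_mset m \<rightarrow> carrier (restrict_ext K K0)"
      using that by auto
    from i.hom_finprod[OF this] show ?thesis
      by (simp add: monomial_def pow comp_def)
  qed
  have "eval_at_indices k (restrict_ext K K0) P = eval_at_indices k K P"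
    if P: "P \<in> ring.indexed_pset k S (carrier k)" and S: "S \<subseteq> K0" for P
  proof -
    note PD = k.indexed_psetD[OF P]
    have mem: "emb K (P m) \<in> K0" "monomial K m \<in> K0" if "P m \<noteq> \<zero>\<^bsub>k\<^esub>" for m
      using emb PD(2)[of m] L.monomial_closed[of m] PD(3)[OF that] S mon[of m] by auto
    then have closed: "(\<lambda>m. emb K (P m) \<otimes>\<^bsub>K\<^esub> monomial K m) \<in> {m. P m \<noteq> \<zero>\<^bsub>k\<^esub>} \<rightarrow> carrier (restrict_ext K K0)"
      using L.m_closed by auto
    from i.hom_finsum[OF closed]
    have "(\<Oplus>\<^bsub>restrict_ext K K0\<^esub>m\<in>{m. P m \<noteq> \<zero>\<^bsub>k\<^esub>}. emb K (P m) \<otimes>\<^bsub>K\<^esub> monomial K m) =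
        eval_at_indices k K P"
      by (simp add: eval_at_indices_alt comp_def)
    moreover have "eval_at_indices k (restrict_ext K K0) P =
      (\<Oplus>\<^bsub>restrict_ext K K0\<^esub>m\<in>{m. P m \<noteq> \<zero>\<^bsub>k\<^esub>}. emb K (P m) \<otimes>\<^bsub>K\<^esub> monomial K m)"
      unfolding eval_at_indices_alt
    proof (intro L.finsum_cong' refl)
      fix m assume "m \<in> {m. P m \<noteq> \<zero>\<^bsub>k\<^esub>}"
      then have "monomial (restrict_ext K K0) m = monomial K m"
        using PD(3)[of m] S by (intro mon) auto
      then show "emb (restrict_ext K K0) (P m) \<otimes>\<^bsub>restrict_ext K K0\<^esub> monomial (restrict_ext K K0) m =
          emb K (P m) \<otimes>\<^bsub>K\<^esub> monomial K m"
        by simp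
    qed (rule closed)
    ultimately show ?thesis by simp
  qed
  then have "(\<forall>P\<in>ring.indexed_pset k S (carrier k). eval_at_indices k (restrict_ext K K0) P = \<zero>\<^bsub>K\<^esub> \<longrightarrow>
        P = (\<lambda>_. \<zero>\<^bsub>k\<^esub>)) \<longleftrightarrow>
      (\<forall>P\<in>ring.indexed_pset k S (carrier k). eval_at_indices k K P = \<zero>\<^bsub>K\<^esub> \<longrightarrow>
        P = (\<lambda>_. \<zero>\<^bsub>k\<^esub>))" if "S \<subseteq> K0"
    using that by (intro ball_cong refl) simp
  then show ?thesis
    using K0 unfolding algebraically_independent_def
    by (cases "S \<subseteq> K0") (simp_all add: subset_trans[of S K0])
qed

section \<open>Transcendence degree of a finitely generated field\<close>

definition bounded_msets :: "'b set \<Rightarrow> nat \<Rightarrow> 'b multiset set" where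
  "bounded_msets A d = {m. set_mset m \<subseteq> A \<and> (\<forall>x. count m x \<le> d)}"

lemma card_bounded_msets:
  assumes "finite A"
  shows "finite (bounded_msets A d)" "card (bounded_msets A d) = Suc d ^ card A"
proof -
  have "bij_betw (\<lambda>m. restrict (count m) A) (bounded_msets A d) (A \<rightarrow>\<^sub>E {..d})"
  proof (rule bij_betwI')
    fix m n assume mn: "m \<in> bounded_msets A d" "n \<in> bounded_msets A d"
    show "restrict (count m) A = restrict (count n) A \<longleftrightarrow> m = n"
    proof
      assume eq: "restrict (count m) A = restrict (count n) A"
      show "m = n"
      proof (rule multiset_eqI)
        fix x show "count m x = count n x"
        proof (cases "x \<in> A")
          case True
          then show ?thesis using fun_cong[OF eq, of x] by simp
        next
          case False
          then have "x \<notin># m" "x \<notin># n"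
            using mn by (auto simp: bounded_msets_def)
          then show ?thesis by (simp add: not_in_iff)
        qed
      qed
    qed simp
  next
    fix m assume "m \<in> bounded_msets A d"
    then show "restrict (count m) A \<in> A \<rightarrow>\<^sub>E {..d}"
      by (auto simp: bounded_msets_def)
  next
    fix f assume f: "f \<in> A \<rightarrow>\<^sub>E {..d}"
    define m where "m = (\<Sum>x\<in>A. replicate_mset (f x) x)"
    have m: "count m y = (if y \<in> A then f y else 0)" for y
    proof -
      have "count m y = (\<Sum>x\<in>A. if y = x then f x else 0)"
        unfolding m_def by (simp add: count_sum)
      then show ?thesis using assms by simp
    qed
    have "set_mset m \<subseteq> A"
      using m by (auto simp: count_greater_zero_iff[symmetric] split: if_splits)
    then have "m \<in> bounded_msets A d"
      using f m by (auto simp: bounded_msets_def)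
    moreover have "f = restrict (count m) A"
      using f m by (auto simp: fun_eq_iff PiE_def extensional_def)
    ultimately show "\<exists>m\<in>bounded_msets A d. f = restrict (count m) A"
      by blast
  qed
  then show "finite (bounded_msets A d)" "card (bounded_msets A d) = Suc d ^ card A"
    using bij_betw_finite bij_betw_same_card assms
    by (fastforce simp: finite_PiE card_PiE)+
qed

lemma size_bounded_mset:
  assumes "finite A" "m \<in> bounded_msets A d"
  shows "size m \<le> d * card A"
proof -
  have "size m = sum (count m) (set_mset m)"
    by (rule size_multiset_overloaded_eq)
  also have "\<dots> \<le> sum (count m) A"
    using assms by (intro sum_mono2) (auto simp: bounded_msets_def)
  also have "\<dots> \<le> (\<Sum>x\<in>A. d)"
    using assms by (intro sum_mono) (auto simp: bounded_msets_def)
  finally show ?thesis by (simp add: mult.commute)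
qed

context ring
begin

lemma combine_map:
  assumes "distinct ms" "f \<in> set ms \<rightarrow> carrier R" "g \<in> set ms \<rightarrow> carrier R"
  shows "combine (map f ms) (map g ms) = (\<Oplus>m\<in>set ms. f m \<otimes> g m)"
  using assms
proof (induction ms)
  case (Cons m ms)
  then have "(\<Oplus>m\<in>insert m (set ms). f m \<otimes> g m) = f m \<otimes> g m \<oplus> (\<Oplus>m\<in>set ms. f m \<otimes> g m)"
    by (intro finsum_insert) auto
  with Cons show ?case by simp
qed simp

text \<open>
  The spanning list \<open>vs\<close> may be dependent, so the argument goes through the dimension of its span.
\<close>

lemma independent_length_le_Span:
  assumes F: "subfield F R" and us: "independent F us" "set us \<subseteq> Span F vs"
    and vs: "set vs \<subseteq> carrier R"
  shows "length us \<le> length vs"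
proof -
  have "\<exists>n\<le>length vs. dimension n F (Span F vs)"
    using vs
  proof (induction vs)
    case Nil
    show ?case by auto
  next
    case (Cons v vs)
    then obtain n where n: "n \<le> length vs" "dimension n F (Span F vs)"
      by auto
    have Span_Cons: "Span F (v # vs) = line_extension F v (Span F vs)"
      by simp
    show ?case
    proof (cases "v \<in> Span F vs")
      case True
      have "Span F (v # vs) = Span F vs"
      proof
        show "Span F (v # vs) \<subseteq> Span F vs"
          using True Cons.prems Span_base_incl[OF F, of vs] by (intro mono_Span_subset[OF F]) auto
        show "Span F vs \<subseteq> Span F (v # vs)"
          using Cons.prems by (intro mono_Span[OF F]) auto
      qed
      with n show ?thesis by (intro exI[of _ n]) (simp del: Span.simps)
    next
      case False
      have "dimension (Suc n) F (Span F (v # vs))"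
        unfolding Span_Cons using Cons.prems False n by (intro Suc_dim) auto
      with n show ?thesis by (intro exI[of _ "Suc n"]) (simp del: Span.simps)
    qed
  qed
  then show ?thesis
    using independent_length_le_dimension[OF F _ us] by (meson order_trans)
qed

end

text \<open>
  Multiplication is bilinear, so it suffices to multiply generators. The auxiliary step fixes one
  factor; it is used once for each factor.
\<close>

lemma (in cring) Span_mult:
  assumes F: "subfield F R"
    and us: "set us \<subseteq> carrier R" and vs: "set vs \<subseteq> carrier R" and ws: "set ws \<subseteq> carrier R"
    and gen: "\<And>u v. u \<in> set us \<Longrightarrow> v \<in> set vs \<Longrightarrow> u \<otimes> v \<in> Span F ws"
    and x: "x \<in> Span F us" and y: "y \<in> Span F vs"
  shows "x \<otimes> y \<in> Span F ws"
proof -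
  have FR: "F \<subseteq> carrier R" using subfieldE(3)[OF F] .
  note Span_closed = Span_subgroup_props[OF F ws]
  have step: "x \<otimes> v \<in> Span F ws"
    if x: "x \<in> Span F us" and us: "set us \<subseteq> carrier R" and v: "v \<in> carrier R"
      and gen: "\<And>u. u \<in> set us \<Longrightarrow> u \<otimes> v \<in> Span F ws" for x v us
  proof -
    have "x \<in> generate (add_monoid R) (F <#> set us)"
      using x Span_eq_generate[OF F us] by simp
    then have "x \<in> carrier R \<and> x \<otimes> v \<in> Span F ws"
    proof (induction rule: generate.induct)
      case one
      show ?case using v Span_closed(2) by simp
    next
      case (incl h)
      then obtain c u where h: "h = c \<otimes> u" "c \<in> F" "u \<in> set us"
        by (auto simp: set_mult_def)
      moreover have "c \<in> carrier R" "u \<in> carrier R"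
        using h FR us by auto
      ultimately have "h \<otimes> v = c \<otimes> (u \<otimes> v)"
        using v by (simp add: m_assoc)
      then show ?case
        using h gen FR us v Span_smult_closed[OF F ws] by (auto simp del: Span.simps)
    next
      case (inv h)
      then obtain c u where h: "h = c \<otimes> u" "c \<in> F" "u \<in> set us"
        by (auto simp: set_mult_def)
      then have hR: "h \<in> carrier R" using FR us by auto
      have "c \<in> carrier R" "u \<in> carrier R"
        using h FR us by auto
      then have "h \<otimes> v = c \<otimes> (u \<otimes> v)"
        using h v by (simp add: m_assoc)
      then have "h \<otimes> v \<in> Span F ws"
        using h gen Span_smult_closed[OF F ws] by (simp del: Span.simps)
      then have "\<ominus> (h \<otimes> v) \<in> Span F ws"
        by (rule Span_closed(4))
      then show ?case
        using hR v by (simp add: l_minus flip: a_inv_def del: Span.simps)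
    next
      case (eng h1 h2)
      then show ?case
        using v Span_closed(3) by (simp add: l_distr del: Span.simps)
    qed
    then show ?thesis by simp
  qed
  have "y \<otimes> u \<in> Span F ws" if u: "u \<in> set us" for u
  proof (rule step[OF y vs])
    show "u \<in> carrier R" using u us by auto
    fix v assume v: "v \<in> set vs"
    then have "v \<otimes> u = u \<otimes> v"
      using u us vs by (intro m_comm) auto
    then show "v \<otimes> u \<in> Span F ws"
      using gen[OF u v] by (simp del: Span.simps)
  qed
  then have "u \<otimes> y \<in> Span F ws" if "u \<in> set us" for u
    using that us Span_subgroup_props(1)[OF F vs] y by (subst m_comm) auto
  then show ?thesis
    using us Span_subgroup_props(1)[OF F vs] y by (intro step[OF x]) auto
qed


definition bounded_monomials :: "('b, 'n) ring_scheme \<Rightarrow> 'b set \<Rightarrow> nat \<Rightarrow> 'b list" where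
  "bounded_monomials R A d =
     map (monomial R) (SOME ms. set ms = bounded_msets A d \<and> distinct ms)"

lemma bounded_monomials:
  assumes "finite A"
  shows "set (bounded_monomials R A d) = monomial R ` bounded_msets A d"
    "length (bounded_monomials R A d) = Suc d ^ card A"
proof -
  let ?ms = "SOME ms. set ms = bounded_msets A d \<and> distinct ms"
  have ms: "set ?ms = bounded_msets A d \<and> distinct ?ms"
    by (rule someI_ex) (rule finite_distinct_list[OF card_bounded_msets(1)[OF assms]])
  then show "set (bounded_monomials R A d) = monomial R ` bounded_msets A d"
    by (simp add: bounded_monomials_def)
  show "length (bounded_monomials R A d) = Suc d ^ card A"
    using ms card_bounded_msets(2)[OF assms, of d] distinct_card[of ?ms]
    by (simp add: bounded_monomials_def)
qed

context field
begin

context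
  fixes F A
  assumes F: "subfield F R" and A: "finite A" "A \<subseteq> carrier R"
begin

text \<open>
  The values at \<open>A\<close> of the polynomials over \<open>F\<close> of degree at most \<open>d\<close> in each variable.
\<close>

definition poly_span :: "nat \<Rightarrow> 'a set" where
  "poly_span d = Span F (bounded_monomials R A d)"

lemma bounded_monomials_closed: "set (bounded_monomials R A d) \<subseteq> carrier R"
  using A monomial_closed by (force simp: bounded_monomials bounded_msets_def)

lemmas poly_span_group =
  Span_subgroup_props[OF F bounded_monomials_closed, folded poly_span_def]

lemma poly_span_base: "m \<in> bounded_msets A d \<Longrightarrow> monomial R m \<in> poly_span d"
  using Span_base_incl[OF F bounded_monomials_closed, of d] A
  by (auto simp: poly_span_def bounded_monomials simp del: Span.simps)

lemma poly_span_mult: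
  assumes "x \<in> poly_span d" "y \<in> poly_span e"
  shows "x \<otimes> y \<in> poly_span (d + e)"
proof -
  have "monomial R m \<otimes> monomial R n \<in> poly_span (d + e)"
    if "m \<in> bounded_msets A d" "n \<in> bounded_msets A e" for m n
  proof -
    have "m + n \<in> bounded_msets A (d + e)"
      using that by (auto simp: bounded_msets_def add_mono)
    moreover have "monomial R (m + n) = monomial R m \<otimes> monomial R n"
      using that A by (intro monomial_union) (auto simp: bounded_msets_def)
    ultimately show ?thesis
      using poly_span_base[of "m + n"] by simp
  qed
  then show ?thesis
    using assms A unfolding poly_span_def
    by (intro Span_mult[OF F bounded_monomials_closed bounded_monomials_closed
          bounded_monomials_closed _ assms[unfolded poly_span_def]])
       (auto simp: bounded_monomials simp del: Span.simps)
qed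

lemma poly_span_one: "\<one> \<in> poly_span d"
  using poly_span_base[of "{#}" d] by (simp add: bounded_msets_def)

lemma poly_span_const: "c \<in> F \<Longrightarrow> c \<in> poly_span d"
  using Span_smult_closed[OF F bounded_monomials_closed, of c \<one> d] poly_span_one[of d]
    subfieldE(3)[OF F]
  by (auto simp: poly_span_def simp del: Span.simps)

lemma poly_span_var: "a \<in> A \<Longrightarrow> a \<in> poly_span 1"
  using poly_span_base[of "{#a#}" 1] monomial_add_mset[of a "{#}"] A
  by (auto simp: bounded_msets_def)

text \<open>
  Elements of \<open>F(A)\<close> are quotients of elements of \<open>F[A]\<close>. Numerator and denominator may be given a
  common degree bound \<open>d\<close>, since the bounds add up along the field operations.
\<close>

lemma generate_field_denominator:
  assumes "h \<in> generate_field R (F \<union> A)"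
  shows "\<exists>d. \<exists>q\<in>poly_span d - {\<zero>}. h \<otimes> q \<in> poly_span d"
  using assms
proof induction
  case one
  show ?case using poly_span_one by (intro exI[of _ 0] bexI[of _ \<one>]) auto
next
  case (incl h)
  then have "h \<in> carrier R" "h \<in> poly_span 1"
    using A(2) subfieldE(3)[OF F] poly_span_const poly_span_var by auto
  then show ?case using poly_span_one by (intro exI[of _ 1] bexI[of _ \<one>]) auto
next
  case (a_inv h)
  then obtain d q where q: "q \<in> poly_span d - {\<zero>}" "h \<otimes> q \<in> poly_span d" by blast
  have "h \<in> carrier R"
    using a_inv.hyps A(2) subfieldE(3)[OF F] generate_field_in_carrier[of "F \<union> A"] by auto
  moreover have "q \<in> carrier R" using q poly_span_group(1) by auto
  ultimately have "\<ominus> h \<otimes> q \<in> poly_span d"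
    using poly_span_group(4)[OF q(2)] by (simp add: l_minus)
  with q show ?case by blast
next
  case (m_inv h)
  then obtain d q where q: "q \<in> poly_span d - {\<zero>}" "h \<otimes> q \<in> poly_span d" by blast
  have h: "h \<in> carrier R"
    using m_inv.hyps A(2) subfieldE(3)[OF F] generate_field_in_carrier[of "F \<union> A"] by auto
  have qR: "q \<in> carrier R" using q poly_span_group(1) by auto
  have "inv h \<in> carrier R" "inv h \<otimes> h = \<one>"
    using h m_inv.hyps field_Units by auto
  then have "inv h \<otimes> (h \<otimes> q) = q"
    using h qR by (simp flip: m_assoc)
  moreover have "h \<otimes> q \<noteq> \<zero>"
    using h qR q m_inv.hyps by (auto simp: integral_iff)
  ultimately show ?case
    using q by (intro exI[of _ d] bexI[of _ "h \<otimes> q"]) auto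
next
  case (eng_add h1 h2)
  then obtain d q e r where q: "q \<in> poly_span d - {\<zero>}" "h1 \<otimes> q \<in> poly_span d"
    and r: "r \<in> poly_span e - {\<zero>}" "h2 \<otimes> r \<in> poly_span e" by blast
  have h: "h1 \<in> carrier R" "h2 \<in> carrier R"
    using eng_add.hyps A(2) subfieldE(3)[OF F] generate_field_in_carrier[of "F \<union> A"] by auto
  have qr: "q \<in> carrier R" "r \<in> carrier R" using q r poly_span_group(1) by auto
  have "(h1 \<oplus> h2) \<otimes> (q \<otimes> r) = (h1 \<otimes> q) \<otimes> r \<oplus> q \<otimes> (h2 \<otimes> r)"
    using h qr by (simp add: l_distr r_distr m_ac)
  then have "(h1 \<oplus> h2) \<otimes> (q \<otimes> r) \<in> poly_span (d + e)"
    using q r by (auto intro!: poly_span_group(3) poly_span_mult)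
  moreover have "q \<otimes> r \<in> poly_span (d + e) - {\<zero>}"
    using q r qr by (auto simp: integral_iff intro!: poly_span_mult)
  ultimately show ?case by blast
next
  case (eng_mult h1 h2)
  then obtain d q e r where q: "q \<in> poly_span d - {\<zero>}" "h1 \<otimes> q \<in> poly_span d"
    and r: "r \<in> poly_span e - {\<zero>}" "h2 \<otimes> r \<in> poly_span e" by blast
  have h: "h1 \<in> carrier R" "h2 \<in> carrier R"
    using eng_mult.hyps A(2) subfieldE(3)[OF F] generate_field_in_carrier[of "F \<union> A"] by auto
  have qr: "q \<in> carrier R" "r \<in> carrier R" using q r poly_span_group(1) by auto
  have "(h1 \<otimes> h2) \<otimes> (q \<otimes> r) = (h1 \<otimes> q) \<otimes> (h2 \<otimes> r)"
    using h qr by (simp add: m_ac)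
  then have "(h1 \<otimes> h2) \<otimes> (q \<otimes> r) \<in> poly_span (d + e)"
    using q r by (auto intro!: poly_span_mult)
  moreover have "q \<otimes> r \<in> poly_span (d + e) - {\<zero>}"
    using q r qr by (auto simp: integral_iff intro!: poly_span_mult)
  ultimately show ?case by blast
qed

lemma generate_field_common_denominator:
  assumes "finite S" "S \<subseteq> generate_field R (F \<union> A)"
  shows "\<exists>d. \<exists>q\<in>poly_span d - {\<zero>}. \<forall>h\<in>S. h \<otimes> q \<in> poly_span d"
  using assms
proof (induction S rule: finite_induct)
  case empty
  show ?case using poly_span_one by (intro exI[of _ 0] bexI[of _ \<one>]) auto
next
  case (insert h S)
  then obtain d q where q: "q \<in> poly_span d - {\<zero>}" "\<forall>g\<in>S. g \<otimes> q \<in> poly_span d"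
    by blast
  obtain e r where r: "r \<in> poly_span e - {\<zero>}" "h \<otimes> r \<in> poly_span e"
    using generate_field_denominator insert.prems by blast
  have qr: "q \<in> carrier R" "r \<in> carrier R" using q r poly_span_group(1) by auto
  have SR: "g \<in> carrier R" if "g \<in> insert h S" for g
    using that insert.prems A(2) subfieldE(3)[OF F] generate_field_in_carrier[of "F \<union> A"] by auto
  have "g \<otimes> (q \<otimes> r) \<in> poly_span (d + e)" if "g \<in> insert h S" for g
  proof (cases "g \<in> S")
    case True
    then have "g \<otimes> (q \<otimes> r) = (g \<otimes> q) \<otimes> r"
      using SR[OF that] qr by (simp add: m_assoc)
    then show ?thesis
      using True q r by (auto intro!: poly_span_mult)
  next
    case False
    then have "g \<otimes> (q \<otimes> r) = q \<otimes> (h \<otimes> r)"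
      using SR[OF that] qr that by (simp add: m_ac)
    then show ?thesis
      using q r by (auto intro!: poly_span_mult)
  qed
  moreover have "q \<otimes> r \<in> poly_span (d + e) - {\<zero>}"
    using q r qr by (auto simp: integral_iff intro!: poly_span_mult)
  ultimately show ?case by blast
qed

text \<open>
  Each of the at most \<open>n\<close> factors of the monomial absorbs one factor \<open>q\<close>; the remaining factors \<open>q\<close>
  have degree at most \<open>d\<close> as well.
\<close>

lemma monomial_clear_denominator:
  assumes q: "q \<in> poly_span d" "\<And>h. h \<in> S \<Longrightarrow> h \<otimes> q \<in> poly_span d" and S: "S \<subseteq> carrier R"
    and m: "set_mset m \<subseteq> S" "size m \<le> n"
  shows "monomial R m \<otimes> q [^] n \<in> poly_span (d * n)"
  using m
proof (induction n arbitrary: m)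
  case 0
  then show ?case using poly_span_one by simp
next
  case (Suc n)
  have qR: "q \<in> carrier R" using q poly_span_group(1) by auto
  show ?case
  proof (cases m)
    case empty
    then show ?thesis
      using Suc.IH[of "{#}"] poly_span_mult[OF q(1), of "q [^] n" "d * n"] qR
      by (simp add: m_comm)
  next
    case (add x m')
    then have xR: "x \<in> carrier R" "monomial R m' \<in> carrier R"
      using Suc.prems S monomial_closed[of m'] by auto
    have "monomial R m = x \<otimes> monomial R m'"
      using add Suc.prems S by (auto intro!: monomial_add_mset)
    then have "monomial R m \<otimes> q [^] Suc n = (x \<otimes> q) \<otimes> (monomial R m' \<otimes> q [^] n)"
      using xR qR by (simp add: m_ac)
    also have "\<dots> \<in> poly_span (d + d * n)"
      using q Suc add by (intro poly_span_mult) auto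
    finally show ?thesis by simp
  qed
qed

text \<open>
  The dimension count: the monomials in \<open>S\<close> with exponents at most \<open>N\<close>, multiplied by the power \<open>n\<close>
  of a common denominator \<open>q\<close>, lie in the span of the monomials in \<open>A\<close> with exponents at most \<open>d n\<close>,
  and for large \<open>N\<close> there are fewer of the latter. Cancelling the power of \<open>q\<close> turns a linear
  relation between the products into one between the monomials in \<open>S\<close>.
\<close>

lemma generate_field_dependent:
  assumes S: "finite S" "S \<subseteq> generate_field R (F \<union> A)" and card: "card A < card S"
  obtains M f where "finite M" "\<forall>m\<in>M. set_mset m \<subseteq> S" "f \<in> M \<rightarrow> F"
    "(\<Oplus>m\<in>M. f m \<otimes> monomial R m) = \<zero>" "\<exists>m\<in>M. f m \<noteq> \<zero>"
proof -
  have SR: "S \<subseteq> carrier R"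
    using S A(2) subfieldE(3)[OF F] generate_field_in_carrier[of "F \<union> A"] by auto
  have FR: "F \<subseteq> carrier R" using subfieldE(3)[OF F] .
  obtain d q where q: "q \<in> poly_span d - {\<zero>}" "\<And>h. h \<in> S \<Longrightarrow> h \<otimes> q \<in> poly_span d"
    using generate_field_common_denominator[OF S] by blast
  have qR: "q \<in> carrier R" using q poly_span_group(1) by auto
  define r s where "r = card A" and "s = card S"
  \<comment> \<open>With this \<open>N\<close>, the dimension is at most \<open>N * Suc N ^ r\<close>, which is less than \<open>Suc N ^ Suc r\<close>.\<close>
  define N where "N = (Suc d * s) ^ r"
  \<comment> \<open>\<open>n\<close> bounds the total degree of the monomials in \<open>S\<close>.\<close>
  define n where "n = N * s"
  have "s \<ge> 1" using card by (simp add: s_def)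
  have large: "Suc (d * n) ^ r < Suc N ^ s"
  proof -
    have "Suc (d * n) \<le> Suc d * s * Suc N"
      using \<open>s \<ge> 1\<close> by (simp add: n_def algebra_simps)
    then have "Suc (d * n) ^ r \<le> (Suc d * s * Suc N) ^ r"
      by (rule power_mono) simp
    also have "\<dots> = N * Suc N ^ r"
      by (simp only: N_def power_mult_distrib)
    also have "\<dots> < Suc N * Suc N ^ r"
      by simp
    also have "\<dots> = Suc N ^ Suc r"
      by simp
    also have "\<dots> \<le> Suc N ^ s"
      using card by (intro power_increasing) (auto simp: r_def s_def)
    finally show ?thesis .
  qed
  obtain ms where ms: "set ms = bounded_msets S N" "distinct ms"
    using finite_distinct_list[OF card_bounded_msets(1)[OF S(1)]] by blast
  have len_ms: "length ms = Suc N ^ s"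
    using distinct_card[OF ms(2)] card_bounded_msets(2)[OF S(1), of N] ms(1) by (simp add: s_def)
  have msS: "set_mset m \<subseteq> S" if "m \<in> set ms" for m
    using that by (auto simp: ms bounded_msets_def)
  have monR: "monomial R m \<in> carrier R" if "m \<in> set ms" for m
    using msS[OF that] SR by (intro monomial_closed) auto
  define g where "g m = monomial R m \<otimes> q [^] n" for m
  have gR: "g \<in> set ms \<rightarrow> carrier R"
    using monR qR by (auto simp: g_def)
  have "g m \<in> poly_span (d * n)" if "m \<in> set ms" for m
  proof -
    have "size m \<le> n"
      using size_bounded_mset[OF S(1), of m N] that by (simp add: ms n_def s_def)
    then show ?thesis
      unfolding g_def using q msS[OF that] SR by (intro monomial_clear_denominator) auto
  qed
  then have "set (map g ms) \<subseteq> Span F (bounded_monomials R A (d * n))"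
    by (auto simp: poly_span_def simp del: Span.simps)
  then have "dependent F (map g ms)"
    using independent_length_le_Span[OF F, of "map g ms" "bounded_monomials R A (d * n)"]
      bounded_monomials_closed bounded_monomials(2)[OF A(1)] large len_ms
    by (metis length_map not_le r_def)
  moreover have "set (map g ms) \<subseteq> carrier R"
    using gR by auto
  ultimately obtain Ks where Ks: "length Ks = length ms" "combine Ks (map g ms) = \<zero>"
    "set Ks \<subseteq> F" "set Ks \<noteq> {\<zero>}"
    using dependent_imp_non_trivial_combine[OF F] by (metis length_map)
  define f where "f m = the (map_of (zip ms Ks) m)" for m
  have Ks_f: "Ks = map f ms"
    using map_of_zip_nth[OF Ks(1)[symmetric] ms(2)] Ks(1)
    by (intro nth_equalityI) (auto simp: f_def)
  have fF: "f \<in> set ms \<rightarrow> F"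
    using Ks(3) by (auto simp: Ks_f)
  have "ms \<noteq> []"
    using len_ms by auto
  have "\<zero> = (\<Oplus>m\<in>set ms. f m \<otimes> g m)"
    using Ks(2) fF FR gR combine_map[OF ms(2), of f g] by (auto simp: Ks_f)
  also have "\<dots> = (\<Oplus>m\<in>set ms. f m \<otimes> monomial R m \<otimes> q [^] n)"
    using fF FR monR qR by (intro finsum_cong') (auto simp: g_def m_assoc)
  also have "\<dots> = (\<Oplus>m\<in>set ms. f m \<otimes> monomial R m) \<otimes> q [^] n"
    using fF FR monR qR by (intro finsum_ldistr[symmetric]) auto
  finally have "(\<Oplus>m\<in>set ms. f m \<otimes> monomial R m) \<otimes> q [^] n = \<zero>" by simp
  moreover have "(\<Oplus>m\<in>set ms. f m \<otimes> monomial R m) \<in> carrier R"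
    using fF FR monR by (intro finsum_closed) auto
  moreover have "q [^] n \<noteq> \<zero>"
    using q qR by (induction n) (auto simp: integral_iff)
  ultimately have "(\<Oplus>m\<in>set ms. f m \<otimes> monomial R m) = \<zero>"
    using qR by (auto simp: integral_iff)
  moreover have "\<exists>m\<in>set ms. f m \<noteq> \<zero>"
    using Ks(4) \<open>ms \<noteq> []\<close> by (cases ms) (auto simp: Ks_f)
  ultimately show ?thesis
    using that[of "set ms" f] msS fF by blast
qed

end

end

lemma intermediate_field_generate:
  assumes K: "field_extension k K" and A: "A \<subseteq> carrier K"
  shows "intermediate_field k K (generate_field K (emb K ` carrier k \<union> A))"
proof -
  interpret K: field K using K by (simp add: field_extension_def)
  have "emb K ` carrier k \<subseteq> carrier K"
    using K by (auto simp: field_extension_def ring_hom_def)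
  then show ?thesis
    using A K.generate_field_is_subfield[of "emb K ` carrier k \<union> A"]
    by (auto simp: intermediate_field_def intro: generate_field.incl)
qed

text \<open>
  A linear relation between monomials in \<open>S\<close> with coefficients in the image of \<open>k\<close> is a nonzero
  polynomial over \<open>k\<close> that vanishes at \<open>S\<close>.
\<close>

lemma trdeg_generate_field_le:
  assumes K: "field_extension k K" and A: "finite A" "A \<subseteq> carrier K"
  shows "trdeg k (restrict_ext K (generate_field K (emb K ` carrier k \<union> A))) \<le> card A"
proof -
  interpret k: field k using K by (simp add: field_extension_def)
  interpret K: field K using K by (simp add: field_extension_def)
  interpret e: ring_hom_ring k K "emb K"
    using K by (intro ring_hom_ringI2 k.ring_axioms K.ring_axioms) (simp add: field_extension_def)
  define F where "F = emb K ` carrier k"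
  have F: "subfield F K"
    unfolding F_def by (rule e.img_is_subfield(2)[OF k.carrier_is_subfield K.one_not_zero])
  have FK: "F \<subseteq> carrier K" using subfieldE(3)[OF F] .
  have "card S \<le> card A"
    if "finite S" "algebraically_independent k (restrict_ext K (generate_field K (F \<union> A))) S" for S
  proof (rule ccontr)
    assume "\<not> card S \<le> card A"
    then have card: "card A < card S" by simp
    have ind: "S \<subseteq> generate_field K (F \<union> A)" "algebraically_independent k K S"
      using that(2) algebraically_independent_restrict[OF K intermediate_field_generate[OF K A(2)]]
      by (auto simp: F_def)
    obtain M f where M: "finite M" "\<forall>m\<in>M. set_mset m \<subseteq> S" "f \<in> M \<rightarrow> F"
      "(\<Oplus>\<^bsub>K\<^esub>m\<in>M. f m \<otimes>\<^bsub>K\<^esub> monomial K m) = \<zero>\<^bsub>K\<^esub>" "\<exists>m\<in>M. f m \<noteq> \<zero>\<^bsub>K\<^esub>"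
      by (rule K.generate_field_dependent[OF F A \<open>finite S\<close> ind(1) card])
    define P where "P m = (if m \<in> M then inv_into (carrier k) (emb K) (f m) else \<zero>\<^bsub>k\<^esub>)" for m
    have f: "f m \<in> emb K ` carrier k" if "m \<in> M" for m
      using M(3) that by (auto simp: F_def)
    have P: "P m \<in> carrier k" "m \<in> M \<Longrightarrow> emb K (P m) = f m" for m
      using f[of m] inv_into_into[of "f m" "emb K" "carrier k"] f_inv_into_f[of "f m" "emb K" "carrier k"]
      by (auto simp: P_def)
    have supp: "{m. P m \<noteq> \<zero>\<^bsub>k\<^esub>} \<subseteq> M"
      by (auto simp: P_def)
    have SK: "S \<subseteq> carrier K"
      using ind(2) by (simp add: algebraically_independent_def)
    have mon: "monomial K m \<in> carrier K" if "m \<in> M" for m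
      using M(2) that SK by (intro K.monomial_closed) auto
    have "P \<in> ring.indexed_pset k S (carrier k)"
      using M(2) P(1) supp by (intro k.indexed_psetI finite_subset[OF supp M(1)]) auto
    moreover have "eval_at_indices k K P = (\<Oplus>\<^bsub>K\<^esub>m\<in>M. emb K (P m) \<otimes>\<^bsub>K\<^esub> monomial K m)"
      unfolding eval_at_indices_alt
    proof (rule K.add.finprod_mono_neutral_cong_left[OF M(1) supp])
      show "emb K (P m) \<otimes>\<^bsub>K\<^esub> monomial K m = \<zero>\<^bsub>K\<^esub>" if "m \<in> M - {m. P m \<noteq> \<zero>\<^bsub>k\<^esub>}" for m
        using that mon[of m] by auto
      show "(\<lambda>m. emb K (P m) \<otimes>\<^bsub>K\<^esub> monomial K m) \<in> M \<rightarrow> carrier K"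
        using P(1) mon by auto
    qed simp
    moreover have "\<dots> = (\<Oplus>\<^bsub>K\<^esub>m\<in>M. f m \<otimes>\<^bsub>K\<^esub> monomial K m)"
    proof (rule K.finsum_cong')
      show "(\<lambda>m. f m \<otimes>\<^bsub>K\<^esub> monomial K m) \<in> M \<rightarrow> carrier K"
        using M(3) FK mon by auto
    qed (simp_all add: P)
    ultimately have "P = (\<lambda>_. \<zero>\<^bsub>k\<^esub>)"
      using ind(2) M(4) by (simp add: algebraically_independent_def)
    then have "f m = \<zero>\<^bsub>K\<^esub>" if "m \<in> M" for m
      using P(2)[OF that] by simp
    with M(5) show False by blast
  qed
  then show ?thesis
    unfolding trdeg_def F_def[symmetric] by (intro SUP_least) simp
qed

section \<open>A field of rational functions in two variables\<close>

text \<open>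
  A polynomial is determined by the list of its coefficients up to its degree, and an infinite set
  has as many finite lists as elements.
\<close>

lemma (in UP_ring) carrier_UP_lepoll:
  assumes "infinite (carrier R)"
  shows "carrier P \<lesssim> carrier R"
proof -
  let ?code = "\<lambda>p. map (up_ring.coeff P p) [0..<Suc (deg R p)]"
  have "inj_on ?code (carrier P)"
  proof (rule inj_onI)
    fix p q assume R: "p \<in> carrier P" "q \<in> carrier P" and eq: "?code p = ?code q"
    have deg: "deg R p = deg R q"
      using arg_cong[OF eq, of length] by simp
    show "p = q"
    proof (rule up_eqI[OF _ R])
      fix n
      show "up_ring.coeff P p n = up_ring.coeff P q n"
      proof (cases "n \<le> deg R p")
        case True
        then show ?thesis
          using eq deg by (simp del: upt_Suc add: map_eq_conv)
      next
        case False
        then show ?thesis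
          using R deg by (simp add: deg_aboveD)
      qed
    qed
  qed
  moreover have "?code ` carrier P \<subseteq> lists (carrier R)"
    by auto
  ultimately have "carrier P \<lesssim> lists (carrier R)"
    unfolding lepoll_def by blast
  moreover have "lists (carrier R) \<lesssim> carrier R"
    using lists_infinite_bij_betw[OF assms] eqpoll_imp_lepoll unfolding eqpoll_def by blast
  ultimately show ?thesis
    by (rule lepoll_trans)
qed

lemma (in domain) carrier_fraction_field_lepoll:
  assumes "infinite (carrier R)"
  shows "carrier (fraction_field R) \<lesssim> carrier R"
proof -
  have "carrier (fraction_field R) \<subseteq> (\<lambda>(p, q). fraction R p q) ` (carrier R \<times> carrier R)"
    by (auto simp: fraction_field_def ring.defs)
  then have "carrier (fraction_field R) \<lesssim> carrier R \<times> carrier R"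
    by (rule subset_image_lepoll)
  moreover have "carrier R \<times> carrier R \<lesssim> carrier R"
    using Times_same_infinite_bij_betw[OF assms] eqpoll_imp_lepoll unfolding eqpoll_def by blast
  ultimately show ?thesis
    by (rule lepoll_trans)
qed

lemma field_extension_transport:
  fixes Q :: "('c, 'q) ring_scheme" and k :: "('a, 'm) ring_scheme"
  assumes k: "field k" and Q: "field Q" and e: "e \<in> ring_hom k Q"
    and small: "carrier Q \<lesssim> (UNIV :: 'b set)"
  obtains K :: "('a, 'b) field_ext" and g where
    "field_extension k K" "g \<in> ring_iso K Q" "\<forall>c\<in>carrier k. g (emb K c) = e c"
proof -
  interpret Q: field Q by fact
  obtain f :: "'c \<Rightarrow> 'b" where f: "inj_on f (carrier Q)"
    using small unfolding lepoll_def by blast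
  define K where "K = ring.extend (image_ring f Q) \<lparr>emb = f \<circ> e\<rparr>"
  have iso: "f \<in> ring_iso Q K"
    using inj_imp_image_ring_iso[OF f]
    by (simp add: K_def ring_iso_def ring_hom_def ring.defs)
  have "field K"
  proof -
    have "K\<lparr>zero := f \<zero>\<^bsub>Q\<^esub>\<rparr> = K"
      by (simp add: K_def ring.defs image_ring_def image_group_def monoid.defs)
    with Q.ring_iso_imp_img_field[OF iso] show ?thesis
      by metis
  qed
  moreover have emb: "emb K = f \<circ> e"
    by (simp add: K_def ring.defs)
  moreover have "f \<circ> e \<in> ring_hom k K"
    using iso ring_hom_trans[OF e, of f K] by (simp add: ring_iso_def)
  ultimately have "field_extension k K"
    using k by (simp add: field_extension_def)
  moreover have "inv_into (carrier Q) f \<in> ring_iso K Q"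
    using ring_iso_set_sym[OF Q.ring_axioms iso] .
  moreover have "inv_into (carrier Q) f (emb K c) = e c" if "c \<in> carrier k" for c
    using that e f by (simp add: emb ring_hom_def Pi_def)
  ultimately show ?thesis
    using that by blast
qed

text \<open>
  The field is \<open>k(x, y)\<close>, built as the field of fractions of \<open>k[x][y]\<close>, with \<open>a = y\<close> and \<open>b = x\<close>. The
  first two components of \<open>w\<close> are the exponents of \<open>y\<close> and \<open>x\<close> in the leading monomial. The third one
  is the trivial degree on \<open>k\<close>, from which the iterated construction starts.
\<close>

lemma exists_field_extension_rank_two:
  fixes k :: "('a, 'm) ring_scheme"
  assumes k: "field k" and inf: "infinite (carrier k)" and small: "carrier k \<lesssim> (UNIV :: 'b set)"
  obtains K :: "('a, 'b) field_ext" and w :: "'b \<Rightarrow> int \<times> int \<times> int" and a b where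
    "field_extension k K" "degree_map K w" "\<forall>c\<in>carrier k - {\<zero>\<^bsub>k\<^esub>}. w (emb K c) = 0"
    "a \<in> carrier K - {\<zero>\<^bsub>K\<^esub>}" "b \<in> carrier K - {\<zero>\<^bsub>K\<^esub>}" "w a = (1, 0, 0)" "w b = (0, 1, 0)"
proof -
  interpret k: field k by fact
  define B where "B = UP k"
  interpret B: UP_domain k B
    by unfold_locales (rule B_def[THEN eq_reflection])
  define A where "A = UP B"
  interpret A: UP_domain B A
    by unfold_locales (rule A_def[THEN eq_reflection])
  interpret Q: field "fraction_field A" by (rule A.field_fraction_field)
  have infB: "infinite (carrier B)"
  proof -
    have "(\<lambda>c. up_ring.monom B c 0) ` carrier k \<subseteq> carrier B"
      by auto
    then show ?thesis
      using inf B.monom_inj[of 0] finite_imageD finite_subset by blast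
  qed
  have infA: "infinite (carrier A)"
  proof -
    have "(\<lambda>c. up_ring.monom A c 0) ` carrier B \<subseteq> carrier A"
      by auto
    then show ?thesis
      using infB A.monom_inj[of 0] finite_imageD finite_subset by blast
  qed
  have smallQ: "carrier (fraction_field A) \<lesssim> (UNIV :: 'b set)"
    using A.carrier_fraction_field_lepoll[OF infA] A.carrier_UP_lepoll[OF infB]
      B.carrier_UP_lepoll[OF inf] small by (meson lepoll_trans)
  define i where "i p = fraction A p \<one>\<^bsub>A\<^esub>" for p
  have i: "i \<in> ring_hom A (fraction_field A)"
    unfolding i_def by (rule A.ring_hom_fraction)
  define e where "e = i \<circ> (\<lambda>p. up_ring.monom A p 0) \<circ> (\<lambda>c. up_ring.monom B c 0)"
  have e: "e \<in> ring_hom k (fraction_field A)"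
    unfolding e_def comp_assoc
    by (rule ring_hom_trans[OF _ i]) (rule ring_hom_trans[OF B.const_ring_hom A.const_ring_hom])
  define wA :: "(nat \<Rightarrow> nat \<Rightarrow> 'a) \<Rightarrow> int \<times> int \<times> int"
    where "wA = UP_degree B (UP_degree k (\<lambda>_. 0))"
  have wA: "degree_map A wA"
    unfolding wA_def by (intro A.degree_map_UP_degree B.degree_map_UP_degree k.degree_map_trivial)
  have wQ: "degree_map (fraction_field A) (A.fraction_degree wA)"
    by (rule A.degree_map_fraction_degree[OF wA])
  have i_nz: "i p \<in> carrier (fraction_field A) - {\<zero>\<^bsub>fraction_field A\<^esub>}"
    and w_i: "A.fraction_degree wA (i p) = wA p" if "p \<in> carrier A - {\<zero>\<^bsub>A\<^esub>}" for p
    using that A.fraction_degree_fraction[OF wA that, of "\<one>\<^bsub>A\<^esub>"] A.degree_map_one[OF wA]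
    by (auto simp: i_def A.fraction_simps)
  have w_monom: "up_ring.monom A (up_ring.monom B c m) n \<in> carrier A - {\<zero>\<^bsub>A\<^esub>}"
    "wA (up_ring.monom A (up_ring.monom B c m) n) = (int n, int m, 0)"
    if c: "c \<in> carrier k - {\<zero>\<^bsub>k\<^esub>}" for c m n
  proof -
    let ?p = "up_ring.monom B c m"
    have cm: "up_ring.coeff B ?p m = c" using c by simp
    have p: "?p \<in> carrier B - {\<zero>\<^bsub>B\<^esub>}"
    proof -
      have "?p \<noteq> \<zero>\<^bsub>B\<^esub>"
        using cm c by (metis B.coeff_zero DiffE singletonI)
      with c show ?thesis by simp
    qed
    have pn: "up_ring.coeff A (up_ring.monom A ?p n) n = ?p" using p by simp
    show "up_ring.monom A ?p n \<in> carrier A - {\<zero>\<^bsub>A\<^esub>}"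
    proof -
      have "up_ring.monom A ?p n \<noteq> \<zero>\<^bsub>A\<^esub>"
        using pn p by (metis A.coeff_zero DiffE singletonI)
      with p show ?thesis by simp
    qed
    have "UP_degree k (\<lambda>_. 0 :: int) ?p = (int m, 0)"
      using c by (simp add: UP_degree_def)
    moreover have "deg B (up_ring.monom A ?p n) = n"
      using p by simp
    ultimately show "wA (up_ring.monom A ?p n) = (int n, int m, 0)"
      using pn by (simp add: wA_def UP_degree_def[of B] flip: A_def)
  qed
  obtain K :: "('a, 'b) field_ext" and g where K: "field_extension k K" "g \<in> ring_iso K (fraction_field A)"
    "\<forall>c\<in>carrier k. g (emb K c) = e c"
    by (rule field_extension_transport[OF k Q.field_axioms e smallQ])
  interpret K: field K using K(1) by (simp add: field_extension_def)
  have g: "ring_hom_ring K (fraction_field A) g" "bij_betw g (carrier K) (carrier (fraction_field A))"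
    using K(2) by (auto simp: ring_iso_def intro!: ring_hom_ringI2 K.ring_axioms Q.ring_axioms)
  interpret g: ring_hom_ring K "fraction_field A" g by (rule g)
  define w where "w x = A.fraction_degree wA (g x)" for x
  have w: "degree_map K w"
    unfolding w_def using g by (intro degree_map_pullback[OF wQ]) (auto simp: bij_betw_def)
  have pre: "\<exists>x\<in>carrier K - {\<zero>\<^bsub>K\<^esub>}. w x = wA p" if p: "p \<in> carrier A - {\<zero>\<^bsub>A\<^esub>}" for p
  proof -
    have "i p \<in> g ` carrier K"
      using g(2) i_nz[OF p] by (simp add: bij_betw_def)
    then obtain x where x: "x \<in> carrier K" "i p = g x"
      by (rule imageE)
    have "x \<noteq> \<zero>\<^bsub>K\<^esub>"
    proof
      assume "x = \<zero>\<^bsub>K\<^esub>"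
      then have "i p = \<zero>\<^bsub>fraction_field A\<^esub>"
        using x by simp
      with i_nz[OF p] show False by blast
    qed
    moreover have "w x = wA p"
      using w_i[OF p] x by (simp add: w_def)
    ultimately show ?thesis
      using x(1) by blast
  qed
  obtain a where a: "a \<in> carrier K - {\<zero>\<^bsub>K\<^esub>}" "w a = (1, 0, 0)"
    using pre[OF w_monom(1)[of "\<one>\<^bsub>k\<^esub>" 0 1]] w_monom(2)[of "\<one>\<^bsub>k\<^esub>" 0 1] by auto
  obtain b where b: "b \<in> carrier K - {\<zero>\<^bsub>K\<^esub>}" "w b = (0, 1, 0)"
    using pre[OF w_monom(1)[of "\<one>\<^bsub>k\<^esub>" 1 0]] w_monom(2)[of "\<one>\<^bsub>k\<^esub>" 1 0] by auto
  have triv: "w (emb K c) = 0" if "c \<in> carrier k - {\<zero>\<^bsub>k\<^esub>}" for c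
    using w_i[OF w_monom(1)[OF that, of 0 0]] w_monom(2)[OF that, of 0 0] K(3) that
    by (simp add: w_def e_def zero_prod_def)
  show ?thesis
    by (rule that[OF K(1) w ballI[OF triv] a(1) b(1) a(2) b(2)])
qed

section \<open>Curves\<close>

text \<open>
  The assumption is that the determinant of the first two components of \<open>w a\<close> and \<open>w b\<close> does not
  vanish, so the two values satisfy no nontrivial linear relation over \<open>\<int>\<close>.
\<close>

lemma inj_on_sum_mset_pair:
  fixes w :: "'b \<Rightarrow> int \<times> int \<times> 'g::comm_monoid_add"
  assumes "fst (w a) * fst (snd (w b)) \<noteq> fst (snd (w a)) * fst (w b)"
  shows "inj_on (\<lambda>m. \<Sum>x\<in>#m. w x) {m. set_mset m \<subseteq> {a, b}}"
proof (rule inj_onI)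
  define u1 u2 v1 v2 where "u1 = fst (w a)" "u2 = fst (snd (w a))" "v1 = fst (w b)" "v2 = fst (snd (w b))"
  have det: "u1 * v2 - u2 * v1 \<noteq> 0"
    using assms by (simp add: u1_u2_v1_v2_def)
  then have "a \<noteq> b"
    by (auto simp: u1_u2_v1_v2_def)
  have sum: "fst (\<Sum>x\<in>#m. w x) = int (count m a) * u1 + int (count m b) * v1 \<and>
     fst (snd (\<Sum>x\<in>#m. w x)) = int (count m a) * u2 + int (count m b) * v2"
    if "set_mset m \<subseteq> {a, b}" for m
    using that
  proof (induction m)
    case (add x m)
    then show ?case
      using \<open>a \<noteq> b\<close> by (auto simp: u1_u2_v1_v2_def algebra_simps)
  qed simp
  fix m n assume "m \<in> {m. set_mset m \<subseteq> {a, b}}" "n \<in> {m. set_mset m \<subseteq> {a, b}}"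
    and eq: "(\<Sum>x\<in>#m. w x) = (\<Sum>x\<in>#n. w x)"
  then have m: "set_mset m \<subseteq> {a, b}" and n: "set_mset n \<subseteq> {a, b}" by auto
  define i j where "i = int (count m a) - int (count n a)" "j = int (count m b) - int (count n b)"
  have lin: "i * u1 + j * v1 = 0" "i * u2 + j * v2 = 0"
    using sum[OF m] sum[OF n] eq by (simp_all add: i_j_def left_diff_distrib)
  have "i * (u1 * v2 - u2 * v1) = (i * u1 + j * v1) * v2 - (i * u2 + j * v2) * v1"
    "j * (u1 * v2 - u2 * v1) = (i * u2 + j * v2) * u1 - (i * u1 + j * v1) * u2"
    by (simp_all add: algebra_simps)
  then have "i * (u1 * v2 - u2 * v1) = 0" "j * (u1 * v2 - u2 * v1) = 0"
    by (simp_all add: lin)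
  then have "count m a = count n a" "count m b = count n b"
    using det by (auto simp: i_j_def)
  moreover have "count m x = 0" "count n x = 0" if "x \<notin> {a, b}" for x
    using m n that unfolding not_in_iff[symmetric] by blast+
  ultimately have "count m x = count n x" for x
    by (cases "x \<in> {a, b}") auto
  then show "m = n"
    by (rule multiset_eqI)
qed

text \<open>
  The multiple of \<open>w x\<close> by \<open>n\<close> is written as a sum because the value group is an arbitrary abelian
  group.
\<close>

lemma (in domain) degree_map_nat_pow:
  assumes w: "degree_map R w" and x: "x \<in> carrier R - {\<zero>}"
  shows "x [^] (n::nat) \<in> carrier R - {\<zero>}" "w (x [^] n) = (\<Sum>i<n. w x)"
proof -
  have "x [^] n \<in> carrier R - {\<zero>} \<and> w (x [^] n) = (\<Sum>i<n. w x)"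
  proof (induction n)
    case 0
    show ?case using degree_map_one[OF w] by simp
  next
    case (Suc n)
    then show ?case
      using degree_map_mult[OF w, of "x [^] n" x] x by (auto simp: integral_iff)
  qed
  then show "x [^] (n::nat) \<in> carrier R - {\<zero>}" "w (x [^] n) = (\<Sum>i<n. w x)" by auto
qed

text \<open>
  The curve is defined over \<open>k(a, b)\<close>.
\<close>

lemma ess_dim_elem_F_El_le_2:
  fixes K :: "('a, 'b) field_ext"
  assumes K: "field_extension k K" and C: "C \<in> fobj F_El K"
  shows "ess_dim_elem k F_El K C \<le> 2"
proof -
  obtain a b where ab: "a \<in> carrier K" "b \<in> carrier K" "C = curve_iso K `` {(a, b)}"
    using C by (auto simp: F_El_def elim!: quotientE)
  define K0 where "K0 = generate_field K (emb K ` carrier k \<union> {a, b})"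
  have K0: "intermediate_field k K K0"
    unfolding K0_def using ab by (intro intermediate_field_generate[OF K]) auto
  have fK: "field K" using K by (simp add: field_extension_def)
  interpret K: field K by fact
  have sub: "subfield K0 K"
    using K0 by (simp add: intermediate_field_def)
  have fL: "field (restrict_ext K K0)"
    by (rule K.subfield_iff(2)[OF sub])
  have hom: "(\<lambda>x. x) \<in> ring_hom (restrict_ext K K0) K"
    using subfieldE(3)[OF sub] by (auto simp: ring_hom_def)
  have mem: "a \<in> K0" "b \<in> K0"
    by (auto simp: K0_def intro: generate_field.incl)
  have "C = fmap F_El (restrict_ext K K0) K (\<lambda>x. x) (curve_iso (restrict_ext K K0) `` {(a, b)})"
    using fmap_F_El_class[OF fL fK hom, of "(a, b)"] mem ab(3) by simp
  moreover have "curve_iso (restrict_ext K K0) `` {(a, b)} \<in> fobj F_El (restrict_ext K K0)"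
    using mem by (auto simp: F_El_def intro!: quotientI)
  ultimately have "ess_dim_elem k F_El K C \<le> trdeg k (restrict_ext K K0)"
    unfolding ess_dim_elem_def using K0 by (intro INF_lower) auto
  also have "\<dots> \<le> card {a, b}"
    unfolding K0_def using ab by (intro trdeg_generate_field_le[OF K]) auto
  also have "\<dots> \<le> 2"
    by (simp add: card_insert_if numeral_eq_enat one_enat_def)
  finally show ?thesis .
qed

text \<open>
  If the curve is defined over \<open>K0\<close>, then \<open>K0\<close> contains \<open>a0 = a l\<^sup>4\<close> and \<open>b0 = b l\<^sup>6\<close> for some
  \<open>l \<in> K\<^sup>*\<close>. The determinant of the values of \<open>a0\<close> and \<open>b0\<close> is odd whatever \<open>w l\<close> is, so these two
  elements of \<open>K0\<close> are algebraically independent.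
\<close>

lemma ess_dim_elem_F_El_ge_2:
  fixes K :: "('a, 'b) field_ext" and w :: "'b \<Rightarrow> int \<times> int \<times> int"
  assumes K: "field_extension k K" and w: "degree_map K w"
    and triv: "\<And>c. c \<in> carrier k - {\<zero>\<^bsub>k\<^esub>} \<Longrightarrow> w (emb K c) = 0"
    and a: "a \<in> carrier K - {\<zero>\<^bsub>K\<^esub>}" "w a = (1, 0, 0)"
    and b: "b \<in> carrier K - {\<zero>\<^bsub>K\<^esub>}" "w b = (0, 1, 0)"
  shows "2 \<le> ess_dim_elem k F_El K (curve_iso K `` {(a, b)})"
  unfolding ess_dim_elem_def
proof (rule INF_greatest)
  have fK: "field K" using K by (simp add: field_extension_def)
  interpret K: field K by fact
  fix K0 assume "K0 \<in> {K0. intermediate_field k K K0 \<and>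
    curve_iso K `` {(a, b)} \<in> fmap F_El (restrict_ext K K0) K (\<lambda>x. x) ` fobj F_El (restrict_ext K K0)}"
  then have K0: "intermediate_field k K K0" and
    "curve_iso K `` {(a, b)} \<in> fmap F_El (restrict_ext K K0) K (\<lambda>x. x) ` fobj F_El (restrict_ext K K0)"
    by auto
  then obtain a0 b0 where mem: "a0 \<in> K0" "b0 \<in> K0" and eq: "curve_iso K `` {(a, b)} =
      fmap F_El (restrict_ext K K0) K (\<lambda>x. x) (curve_iso (restrict_ext K K0) `` {(a0, b0)})"
    by (auto simp: F_El_def elim!: quotientE)
  have sub: "subfield K0 K"
    using K0 by (simp add: intermediate_field_def)
  have fL: "field (restrict_ext K K0)"
    by (rule K.subfield_iff(2)[OF sub])
  have K0K: "K0 \<subseteq> carrier K" by (rule subfieldE(3)[OF sub])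
  have hom: "(\<lambda>x. x) \<in> ring_hom (restrict_ext K K0) K"
    using K0K by (auto simp: ring_hom_def)
  have "curve_iso K `` {(a, b)} = curve_iso K `` {(a0, b0)}"
    using eq fmap_F_El_class[OF fL fK hom, of "(a0, b0)"] mem by simp
  then have "((a, b), (a0, b0)) \<in> curve_iso K"
    using eq_equiv_class[OF _ equiv_curve_iso[OF fK], of "(a, b)" "(a0, b0)"] mem K0K by blast
  then obtain l where l: "l \<in> Units K" "a0 = a \<otimes>\<^bsub>K\<^esub> l [^]\<^bsub>K\<^esub> (4::nat)" "b0 = b \<otimes>\<^bsub>K\<^esub> l [^]\<^bsub>K\<^esub> (6::nat)"
    by (auto simp: curve_iso_def)
  have "l \<in> carrier K - {\<zero>\<^bsub>K\<^esub>}"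
    using l(1) K.field_Units by simp
  note pow = K.degree_map_nat_pow[OF w this]
  have nz: "a0 \<in> carrier K - {\<zero>\<^bsub>K\<^esub>}" "b0 \<in> carrier K - {\<zero>\<^bsub>K\<^esub>}"
    unfolding l using a b pow(1) by (auto simp: K.integral_iff)
  obtain p q r where pqr: "w l = (p, q, r)" by (metis prod.exhaust)
  have sums: "(\<Sum>i<n. w l) = (int n * p, int n * q, int n * r)" for n :: nat
    unfolding pqr by (induction n) (auto simp: zero_prod_def algebra_simps)
  have w0: "w a0 = (1 + 4 * p, 4 * q, 4 * r)" "w b0 = (6 * p, 1 + 6 * q, 6 * r)"
    unfolding l using degree_map_mult[OF w a(1) pow(1)] degree_map_mult[OF w b(1) pow(1)]
    by (simp_all only: pow(2) sums a b) simp_all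
  have "(1 + 4 * p) * (1 + 6 * q) - 4 * q * (6 * p) = 2 * (2 * p + 3 * q) + 1"
    by (simp add: algebra_simps)
  then have det: "(1 + 4 * p) * (1 + 6 * q) \<noteq> 4 * q * (6 * p)"
    by presburger
  have "a0 \<noteq> b0"
  proof
    assume "a0 = b0"
    then have "4 * q = 1 + 6 * q"
      using w0 by simp
    then show False by presburger
  qed
  have "algebraically_independent k K {a0, b0}"
    using nz det by (intro algebraically_independentI_degree[OF K w triv] inj_on_sum_mset_pair) (auto simp: w0)
  then have "algebraically_independent k (restrict_ext K K0) {a0, b0}"
    using algebraically_independent_restrict[OF K K0] mem by simp
  then have "enat (card {a0, b0}) \<le> trdeg k (restrict_ext K K0)"
    unfolding trdeg_def by (intro SUP_upper) auto
  then show "2 \<le> trdeg k (restrict_ext K K0)"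
    using \<open>a0 \<noteq> b0\<close> by (simp add: numeral_eq_enat numeral_2_eq_2)
qed

lemma (in field) infinite_carrier_char_zero:
  assumes "\<forall>n::nat. n > 0 \<longrightarrow> add_pow R n \<one> \<noteq> \<zero>"
  shows "infinite (carrier R)"
proof -
  have closed: "add_pow R n \<one> \<in> carrier R" for n :: nat
    by (rule add.nat_pow_closed) simp
  have le: "m = n" if eq: "add_pow R m \<one> = add_pow R n \<one>" and "m \<le> n" for m n :: nat
  proof -
    have "add_pow R m \<one> \<oplus> add_pow R (n - m) \<one> = add_pow R m \<one> \<oplus> \<zero>"
      using add.nat_pow_mult[OF one_closed, of m "n - m"] \<open>m \<le> n\<close> closed[of m]
      by (simp only: le_add_diff_inverse eq r_zero)
    then have "add_pow R (n - m) \<one> = \<zero>"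
      using closed add.l_cancel by blast
    then have "\<not> n - m > 0"
      using assms by blast
    with \<open>m \<le> n\<close> show ?thesis by simp
  qed
  have "inj (\<lambda>n::nat. add_pow R n \<one>)"
  proof (rule injI)
    fix m n :: nat assume "add_pow R m \<one> = add_pow R n \<one>"
    then show "m = n"
      using le[of m n] le[of n m] by (cases "m \<le> n") simp_all
  qed
  moreover have "range (\<lambda>n::nat. add_pow R n \<one>) \<subseteq> carrier R"
    using closed by blast
  ultimately show ?thesis
    by (rule infinite_super[rotated, OF range_inj_infinite])
qed

theorem corollary4p2:
  fixes k :: "'a ring"
  assumes "algebraically_closed k"
    and char_zero: "\<forall>n::nat. n > 0 \<longrightarrow> [n] \<cdot>\<^bsub>k\<^esub> \<one>\<^bsub>k\<^esub> \<noteq> \<zero>\<^bsub>k\<^esub>"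
    and large_enough: "\<exists>h :: 'a \<Rightarrow> 'b. inj_on h (carrier k)"
  shows "ess_dim k (F_El :: ('a, 'b, ('b \<times> 'b) set) ext_functor) = 2"
proof (rule antisym)
  show "ess_dim k (F_El :: ('a, 'b, ('b \<times> 'b) set) ext_functor) \<le> 2"
    unfolding ess_dim_def by (intro SUP_least ess_dim_elem_F_El_le_2) auto
next
  interpret k: algebraically_closed k by fact
  have "carrier k \<lesssim> (UNIV :: 'b set)"
    using large_enough by (auto simp: lepoll_def)
  then obtain K :: "('a, 'b) field_ext" and w :: "'b \<Rightarrow> int \<times> int \<times> int" and a b where
    K: "field_extension k K" "degree_map K w" "\<forall>c\<in>carrier k - {\<zero>\<^bsub>k\<^esub>}. w (emb K c) = 0"
    "a \<in> carrier K - {\<zero>\<^bsub>K\<^esub>}" "b \<in> carrier K - {\<zero>\<^bsub>K\<^esub>}" "w a = (1, 0, 0)" "w b = (0, 1, 0)"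
    by (rule exists_field_extension_rank_two[OF k.field_axioms
          k.infinite_carrier_char_zero[OF char_zero]])
  have "2 \<le> ess_dim_elem k F_El K (curve_iso K `` {(a, b)})"
    using K(3) by (intro ess_dim_elem_F_El_ge_2[OF K(1,2) _ K(4,6,5,7)]) auto
  also have "\<dots> \<le> (SUP C\<in>fobj F_El K. ess_dim_elem k F_El K C)"
    using K by (intro SUP_upper) (auto simp: F_El_def intro!: quotientI)
  also have "\<dots> \<le> ess_dim k (F_El :: ('a, 'b, ('b \<times> 'b) set) ext_functor)"
    unfolding ess_dim_def using K(1) by (intro SUP_upper) simp
  finally show "2 \<le> ess_dim k (F_El :: ('a, 'b, ('b \<times> 'b) set) ext_functor)" .
qed

end
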